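(* Let $K$ be a field, $G$ a group with neutral element $1$, and let $\Gamma$ be any elementary $G$-grading on the associative algebra $UT_n$ of upper triangular $n\times n$ matrices over $K$, defined by the sequence $(g_1,g_2,\ldots,g_n)\in G^n$ with $g_1=1$, i.e. $\deg e_{ij}=g_ig_j^{-1}$ for all $i\le j$. Then $$\mathrm{Aut}(\Gamma)=\mathrm{Stab}(\Gamma)=\{\varphi_a\mid a\in UT_n\text{ invertible and homogeneous of degree }1\},$$ $$W(\Gamma)=1,$$ $$\mathrm{Diag}(\Gamma)=\{\varphi_{a_\chi}\mid \chi\in\widehat{U(\Gamma)},\ a_\chi=\mathrm{diag}(1,\chi(g_2),\ldots,\chi(g_n))\}.$$
   Context: A $G$-grading $\Gamma$ on an algebra $A$ is a vector space decomposition $A=\bigoplus_{g\in G}A_g$ with $A_gA_h\subset A_{gh}$ for all $g,h\in G$; $\mathrm{Supp}\,\Gamma=\{g\in G\mid A_g\neq 0\}$; nonzero elements of $A_g$ are called homogeneous of degree $g$. Let $e_{ij}$ denote the matrix units. A grading on $UT_n$ is elementary if all $e_{ij}$ ($i\le j$) are homogeneous. For a grading $\Gamma$ on $A$: - $\mathrm{Aut}(\Gamma)$ is the group of self-equivalences: algebra automorphisms $f$ of $A$ such that for every $g\in\mathrm{Supp}\,\Gamma$ there is $h\in\mathrm{Supp}\,\Gamma$ with $f(A_g)=A_h$. - $\mathrm{Stab}(\Gamma)=\mathrm{Aut}_G(A)$ is the group of graded automorphisms, i.e. algebra automorphisms $f$ with $f(A_g)= A_g$ for all $g$. - $\mathrm{Diag}(\Gamma)$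 is the set of $f\in\mathrm{Stab}(\Gamma)$ such that for each $g\in\mathrm{Supp}\,\Gamma$ there is $\lambda_g\in K$ with $f(x)=\lambda_g x$ for all $x\in A_g$. - $W(\Gamma)=\mathrm{Aut}(\Gamma)/\mathrm{Stab}(\Gamma)$ is the Weyl group ($\mathrm{Stab}(\Gamma)$ is normal in $\mathrm{Aut}(\Gamma)$). For an invertible $a\in UT_n$, $\varphi_a:UT_n\to UT_n$ is $\varphi_a(x)=axa^{-1}$. The Universal group grading $U(\Gamma)$ is the group generated by the set $\mathrm{Supp}\,\Gamma$ subject to the relations $bc=a$ for all $a,b,c\in\mathrm{Supp}\,\Gamma$ with $0\neq A_bA_c\subset A_a$; $\mathrm{Supp}\,\Gamma$ is regarded as a subset of $U(\Gamma)$. For a group $H$, $\widehat H$ is the set of group homomorphisms $H\to K^\ast$. For $\chi\in\widehat{U(\Gamma)}$, $\chi(g_i)$ means $\chi(\deg e_{1i})^{-1}$ (note $\deg e_{1i}=g_i^{-1}\in\mathrm{Supp}\,\Gamma\subset U(\Gamma)$). *)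

theory Defs
  imports
    "Jordan_Normal_Form.Matrix"
    "HOL-Algebra.Coset"
    "HOL-Algebra.Bij"
    "HOL-Algebra.Elementary_Groups"
begin

section \<open>Gradings on an algebra over a field\<close>

text \<open>
  An algebra over the field \<open>'k\<close> is a record of type \<open>('k, 'v) module\<close>; all of \<open>'k\<close> acts
  through the field \<open>smult\<close>.  Only the values \<open>\<Gamma> g\<close> with \<open>g \<in> carrier G\<close> are ever used.
\<close>

definition linear_subspace :: "('k::field, 'v) module \<Rightarrow> 'v set \<Rightarrow> bool" where
  "linear_subspace A S \<longleftrightarrow>
     subgroup S (add_monoid A) \<and> (\<forall>c. \<forall>x\<in>S. c \<odot>\<^bsub>A\<^esub> x \<in> S)"

text \<open>
  In an internal direct sum every element is a sum of a unique finitely supported family.  The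
  sum is taken over the support only, because \<open>finsum\<close> is zero on infinite index sets.
\<close>

definition is_direct_sum ::
  "('g, 'm) monoid_scheme \<Rightarrow> ('k::field, 'v) module \<Rightarrow> ('g \<Rightarrow> 'v set) \<Rightarrow> bool" where
  "is_direct_sum G A \<Gamma> \<longleftrightarrow>
     (\<forall>g\<in>carrier G. linear_subspace A (\<Gamma> g)) \<and>
     (\<forall>x\<in>carrier A. \<exists>!f. f \<in> (\<Pi>\<^sub>E g\<in>carrier G. \<Gamma> g) \<and>
        finite {g \<in> carrier G. f g \<noteq> \<zero>\<^bsub>A\<^esub>} \<and>
        x = (\<Oplus>\<^bsub>A\<^esub>g\<in>{g \<in> carrier G. f g \<noteq> \<zero>\<^bsub>A\<^esub>}. f g))"

definition is_grading ::
  "('g, 'm) monoid_scheme \<Rightarrow> ('k::field, 'v) module \<Rightarrow> ('g \<Rightarrow> 'v set) \<Rightarrow> bool" where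
  "is_grading G A \<Gamma> \<longleftrightarrow>
     is_direct_sum G A \<Gamma> \<and>
     (\<forall>g\<in>carrier G. \<forall>h\<in>carrier G. \<Gamma> g <#>\<^bsub>A\<^esub> \<Gamma> h \<subseteq> \<Gamma> (g \<otimes>\<^bsub>G\<^esub> h))"

definition Supp ::
  "('g, 'm) monoid_scheme \<Rightarrow> ('k::field, 'v) module \<Rightarrow> ('g \<Rightarrow> 'v set) \<Rightarrow> 'g set" where
  "Supp G A \<Gamma> = {g \<in> carrier G. \<Gamma> g \<noteq> {\<zero>\<^bsub>A\<^esub>}}"

definition homogeneous ::
  "('k::field, 'v) module \<Rightarrow> ('g \<Rightarrow> 'v set) \<Rightarrow> 'g \<Rightarrow> 'v \<Rightarrow> bool" where
  "homogeneous A \<Gamma> g x \<longleftrightarrow> x \<in> \<Gamma> g \<and> x \<noteq> \<zero>\<^bsub>A\<^esub>"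

section \<open>Automorphism groups of a grading\<close>

text \<open>
  Automorphisms are extensional functions on \<open>carrier A\<close> (as in \<open>Bij\<close>), so that two of them are
  equal in HOL exactly if they agree on \<open>A\<close>.
\<close>

definition algebra_aut :: "('k::field, 'v) module \<Rightarrow> ('v \<Rightarrow> 'v) set" where
  "algebra_aut A = {f \<in> Bij (carrier A). f \<in> ring_hom A A \<and>
     (\<forall>c. \<forall>x\<in>carrier A. f (c \<odot>\<^bsub>A\<^esub> x) = c \<odot>\<^bsub>A\<^esub> f x)}"

definition Aut_grading ::
  "('g, 'm) monoid_scheme \<Rightarrow> ('k::field, 'v) module \<Rightarrow> ('g \<Rightarrow> 'v set) \<Rightarrow> ('v \<Rightarrow> 'v) set" where
  "Aut_grading G A \<Gamma> = {f \<in> algebra_aut A.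
     \<forall>g\<in>Supp G A \<Gamma>. \<exists>h\<in>Supp G A \<Gamma>. f ` \<Gamma> g = \<Gamma> h}"

definition Stab_grading ::
  "('g, 'm) monoid_scheme \<Rightarrow> ('k::field, 'v) module \<Rightarrow> ('g \<Rightarrow> 'v set) \<Rightarrow> ('v \<Rightarrow> 'v) set" where
  "Stab_grading G A \<Gamma> = {f \<in> algebra_aut A. \<forall>g\<in>carrier G. f ` \<Gamma> g = \<Gamma> g}"

definition Diag_grading ::
  "('g, 'm) monoid_scheme \<Rightarrow> ('k::field, 'v) module \<Rightarrow> ('g \<Rightarrow> 'v set) \<Rightarrow> ('v \<Rightarrow> 'v) set" where
  "Diag_grading G A \<Gamma> = {f \<in> Stab_grading G A \<Gamma>.
     \<forall>g\<in>Supp G A \<Gamma>. \<exists>c. \<forall>x\<in>\<Gamma> g. f x = c \<odot>\<^bsub>A\<^esub> x}"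

definition Weyl_group ::
  "('g, 'm) monoid_scheme \<Rightarrow> ('k::field, 'v) module \<Rightarrow> ('g \<Rightarrow> 'v set) \<Rightarrow> ('v \<Rightarrow> 'v) set monoid"
  where
  "Weyl_group G A \<Gamma> =
     (BijGroup (carrier A)\<lparr>carrier := Aut_grading G A \<Gamma>\<rparr>) Mod Stab_grading G A \<Gamma>"

section \<open>Groups given by generators and relations\<close>

text \<open>
  The letter \<open>(x, True)\<close> stands for the generator \<open>x\<close> and \<open>(x, False)\<close> for its formal inverse.
  A pair \<open>(l, r)\<close> of words in \<open>R\<close> stands for the relation \<open>l = r\<close>.
\<close>

type_synonym 's word = "('s \<times> bool) list"

definition group_words :: "'s set \<Rightarrow> 's word set" where
  "group_words S = lists (S \<times> UNIV)"

inductive_set pres_rel :: "'s set \<Rightarrow> ('s word \<times> 's word) set \<Rightarrow> ('s word \<times> 's word) set"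
  for S :: "'s set" and R :: "('s word \<times> 's word) set" where
  refl: "u \<in> group_words S \<Longrightarrow> (u, u) \<in> pres_rel S R"
| sym: "(u, v) \<in> pres_rel S R \<Longrightarrow> (v, u) \<in> pres_rel S R"
| trans: "(u, v) \<in> pres_rel S R \<Longrightarrow> (v, w) \<in> pres_rel S R \<Longrightarrow> (u, w) \<in> pres_rel S R"
| cancel: "u \<in> group_words S \<Longrightarrow> v \<in> group_words S \<Longrightarrow> x \<in> S \<Longrightarrow>
    (u @ [(x, b), (x, \<not> b)] @ v, u @ v) \<in> pres_rel S R"
| rel: "u \<in> group_words S \<Longrightarrow> v \<in> group_words S \<Longrightarrow> (l, r) \<in> R \<Longrightarrow>
    l \<in> group_words S \<Longrightarrow> r \<in> group_words S \<Longrightarrow>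
    (u @ l @ v, u @ r @ v) \<in> pres_rel S R"

definition presented_group ::
  "'s set \<Rightarrow> ('s word \<times> 's word) set \<Rightarrow> 's word set monoid" where
  "presented_group S R = \<lparr>
     carrier = group_words S // pres_rel S R,
     mult = (\<lambda>X Y. \<Union>u\<in>X. \<Union>v\<in>Y. pres_rel S R `` {u @ v}),
     one = pres_rel S R `` {[]}\<rparr>"

definition pres_gen :: "'s set \<Rightarrow> ('s word \<times> 's word) set \<Rightarrow> 's \<Rightarrow> 's word set" where
  "pres_gen S R x = pres_rel S R `` {[(x, True)]}"

subsection \<open>The presented group is a group\<close>

lemma pres_rel_words:
  "(u, v) \<in> pres_rel S R \<Longrightarrow> u \<in> group_words S \<and> v \<in> group_words S"
  by (induction rule: pres_rel.induct) (auto simp: group_words_def)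

lemma equiv_pres_rel: "equiv (group_words S) (pres_rel S R)"
proof (rule equivI)
  show "refl_on (group_words S) (pres_rel S R)"
    by (auto simp: refl_on_def intro: pres_rel.refl)
  show "pres_rel S R \<subseteq> group_words S \<times> group_words S"
    using pres_rel_words by auto
  show "sym (pres_rel S R)" by (auto intro: symI pres_rel.sym)
  show "trans (pres_rel S R)" by (auto intro: transI pres_rel.trans)
qed

lemma pres_rel_append_context:
  assumes "(u, v) \<in> pres_rel S R" "p \<in> group_words S" "q \<in> group_words S"
  shows "(p @ u @ q, p @ v @ q) \<in> pres_rel S R"
  using assms
proof (induction rule: pres_rel.induct)
  case (refl u)
  then show ?case by (auto simp: group_words_def intro!: pres_rel.refl)
next
  case (sym u v)
  then show ?case by (blast intro: pres_rel.sym)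
next
  case (trans u v w)
  then show ?case by (blast intro: pres_rel.trans)
next
  case (cancel u v x b)
  then show ?case
    using pres_rel.cancel[of "p @ u" S "v @ q" x b R] by (simp add: group_words_def)
next
  case (rel u v l r)
  then show ?case
    using pres_rel.rel[of "p @ u" S "v @ q" l r R] by (simp add: group_words_def)
qed

lemma pres_rel_append:
  assumes "(u, u') \<in> pres_rel S R" "(v, v') \<in> pres_rel S R"
  shows "(u @ v, u' @ v') \<in> pres_rel S R"
proof -
  have w: "[] \<in> group_words S" "v \<in> group_words S" "u' \<in> group_words S"
    using pres_rel_words[OF assms(1)] pres_rel_words[OF assms(2)] by (simp_all add: group_words_def)
  have "(u @ v, u' @ v) \<in> pres_rel S R"
    using pres_rel_append_context[OF assms(1) w(1) w(2)] by simp
  moreover have "(u' @ v, u' @ v') \<in> pres_rel S R"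
    using pres_rel_append_context[OF assms(2) w(3) w(1)] by simp
  ultimately show ?thesis by (rule pres_rel.trans)
qed

lemma presented_group_mult:
  assumes "u \<in> group_words S" "v \<in> group_words S"
  shows "(pres_rel S R `` {u}) \<otimes>\<^bsub>presented_group S R\<^esub> (pres_rel S R `` {v}) =
    pres_rel S R `` {u @ v}"
proof -
  have "congruent2 (pres_rel S R) (pres_rel S R) (\<lambda>u v. pres_rel S R `` {u @ v})"
    using equiv_class_eq[OF equiv_pres_rel] pres_rel_append
    by (fastforce simp: congruent2_def)
  from UN_equiv_class2[OF equiv_pres_rel equiv_pres_rel this assms]
  show ?thesis by (simp add: presented_group_def)
qed

lemma pres_rel_left_inverse:
  "u \<in> group_words S \<Longrightarrow> \<exists>v\<in>group_words S. (v @ u, []) \<in> pres_rel S R"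
proof (induction u)
  case Nil
  then show ?case by (auto intro!: bexI[of _ "[]"] pres_rel.refl simp: group_words_def)
next
  case (Cons a u)
  obtain x b where a: "a = (x, b)" "x \<in> S" "u \<in> group_words S"
    using Cons.prems by (cases a) (auto simp: group_words_def)
  obtain v where v: "v \<in> group_words S" "(v @ u, []) \<in> pres_rel S R"
    using Cons.IH a by blast
  have "(v @ [(x, \<not> b), (x, \<not> \<not> b)] @ u, v @ u) \<in> pres_rel S R"
    by (rule pres_rel.cancel[OF v(1) a(3) a(2)])
  then have "((v @ [(x, \<not> b)]) @ a # u, []) \<in> pres_rel S R"
    using v(2) a by (auto intro: pres_rel.trans)
  moreover have "v @ [(x, \<not> b)] \<in> group_words S" using v a by (simp add: group_words_def)
  ultimately show ?case by blast
qed

lemma group_presented_group: "group (presented_group S R)"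
proof (rule groupI)
  let ?P = "presented_group S R" and ?c = "\<lambda>u. pres_rel S R `` {u}"
  have nil: "[] \<in> group_words S" by (simp add: group_words_def)
  have app: "u \<in> group_words S \<Longrightarrow> v \<in> group_words S \<Longrightarrow> u @ v \<in> group_words S" for u v
    by (simp add: group_words_def)
  have car: "X \<in> carrier ?P \<longleftrightarrow> (\<exists>u\<in>group_words S. X = ?c u)" for X
    by (auto simp: presented_group_def quotient_def)
  have one: "\<one>\<^bsub>?P\<^esub> = ?c []" by (simp add: presented_group_def)
  show "\<one>\<^bsub>?P\<^esub> \<in> carrier ?P" using car one nil by blast
  fix X assume "X \<in> carrier ?P"
  then obtain u where u: "u \<in> group_words S" "X = ?c u" using car by blast
  show "\<one>\<^bsub>?P\<^esub> \<otimes>\<^bsub>?P\<^esub> X = X" using u nil one by (simp add: presented_group_mult)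
  obtain v where v: "v \<in> group_words S" "(v @ u, []) \<in> pres_rel S R"
    using pres_rel_left_inverse[OF u(1)] by blast
  have "?c v \<otimes>\<^bsub>?P\<^esub> X = \<one>\<^bsub>?P\<^esub>"
    using v u one equiv_class_eq[OF equiv_pres_rel v(2)] by (simp add: presented_group_mult)
  then show "\<exists>Y\<in>carrier ?P. Y \<otimes>\<^bsub>?P\<^esub> X = \<one>\<^bsub>?P\<^esub>" using car v by blast
  fix Y assume "Y \<in> carrier ?P"
  then obtain w where w: "w \<in> group_words S" "Y = ?c w" using car by blast
  show "X \<otimes>\<^bsub>?P\<^esub> Y \<in> carrier ?P"
    using u w car app by (auto simp: presented_group_mult)
  fix Z assume "Z \<in> carrier ?P"
  then obtain z where z: "z \<in> group_words S" "Z = ?c z" using car by blast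
  show "X \<otimes>\<^bsub>?P\<^esub> Y \<otimes>\<^bsub>?P\<^esub> Z = X \<otimes>\<^bsub>?P\<^esub> (Y \<otimes>\<^bsub>?P\<^esub> Z)"
    using u w z app by (simp add: presented_group_mult)
qed

section \<open>The universal grading group and its characters\<close>

text \<open>
  The product \<open>\<Gamma> b <#> \<Gamma> c\<close> is the set of products \<open>x y\<close>, not its linear span; both conditions
  below are unaffected by passing to the span.
\<close>

definition universal_rels ::
  "('g, 'm) monoid_scheme \<Rightarrow> ('k::field, 'v) module \<Rightarrow> ('g \<Rightarrow> 'v set) \<Rightarrow> ('g word \<times> 'g word) set"
  where
  "universal_rels G A \<Gamma> = {([(b, True), (c, True)], [(a, True)]) | a b c.
     a \<in> Supp G A \<Gamma> \<and> b \<in> Supp G A \<Gamma> \<and> c \<in> Supp G A \<Gamma> \<and>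
     \<not> \<Gamma> b <#>\<^bsub>A\<^esub> \<Gamma> c \<subseteq> {\<zero>\<^bsub>A\<^esub>} \<and> \<Gamma> b <#>\<^bsub>A\<^esub> \<Gamma> c \<subseteq> \<Gamma> a}"

definition universal_group ::
  "('g, 'm) monoid_scheme \<Rightarrow> ('k::field, 'v) module \<Rightarrow> ('g \<Rightarrow> 'v set) \<Rightarrow> 'g word set monoid" where
  "universal_group G A \<Gamma> = presented_group (Supp G A \<Gamma>) (universal_rels G A \<Gamma>)"

definition universal_deg ::
  "('g, 'm) monoid_scheme \<Rightarrow> ('k::field, 'v) module \<Rightarrow> ('g \<Rightarrow> 'v set) \<Rightarrow> 'g \<Rightarrow> 'g word set" where
  "universal_deg G A \<Gamma> g = pres_gen (Supp G A \<Gamma>) (universal_rels G A \<Gamma>) g"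

definition field_units :: "'k::field monoid" where
  "field_units = \<lparr>carrier = UNIV - {0}, mult = (*), one = 1\<rparr>"

definition characters :: "('h, 'm) monoid_scheme \<Rightarrow> ('h \<Rightarrow> 'k::field) set" where
  "characters H = hom H field_units"

section \<open>Upper triangular matrices\<close>

definition UT :: "nat \<Rightarrow> ('k::field, 'k mat) module" where
  "UT n = (module_mat TYPE('k) n n)\<lparr>carrier := {M \<in> carrier_mat n n. upper_triangular M}\<rparr>"

text \<open>Rows and columns are numbered from \<open>0\<close> to \<open>n - 1\<close>.\<close>

definition e_unit :: "nat \<Rightarrow> nat \<Rightarrow> nat \<Rightarrow> 'k::field mat" where
  "e_unit n i j = Matrix.mat n n (\<lambda>(k, l). if k = i \<and> l = j then 1 else 0)"

definition elementary_grading ::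
  "('g, 'm) monoid_scheme \<Rightarrow> nat \<Rightarrow> ('g \<Rightarrow> 'k::field mat set) \<Rightarrow> bool" where
  "elementary_grading G n \<Gamma> \<longleftrightarrow>
     is_grading G (UT n) \<Gamma> \<and>
     (\<forall>i j. i \<le> j \<and> j < n \<longrightarrow> (\<exists>g\<in>carrier G. homogeneous (UT n) \<Gamma> g (e_unit n i j)))"

definition conj_map :: "nat \<Rightarrow> 'k::field mat \<Rightarrow> 'k mat \<Rightarrow> 'k mat" where
  "conj_map n a = (\<lambda>x\<in>carrier (UT n). a \<otimes>\<^bsub>UT n\<^esub> x \<otimes>\<^bsub>UT n\<^esub> inv\<^bsub>UT n\<^esub> a)"

text \<open>
  The matrix \<open>diag(1, \<chi>(g\<^sub>1), \<dots>, \<chi>(g\<^sub>n\<^sub>-\<^sub>1))\<close>, where \<open>\<chi>(g\<^sub>i)\<close> stands for \<open>\<chi>(deg e\<^sub>0\<^sub>i)\<close> inverted and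
  \<open>deg e\<^sub>0\<^sub>i\<close> is the inverse of \<open>g\<^sub>i\<close> because \<open>g\<^sub>0\<close> is the neutral element.
\<close>

definition char_diag ::
  "('g, 'm) monoid_scheme \<Rightarrow> nat \<Rightarrow> ('g \<Rightarrow> 'k::field mat set) \<Rightarrow> (nat \<Rightarrow> 'g) \<Rightarrow>
   ('g word set \<Rightarrow> 'k) \<Rightarrow> 'k mat" where
  "char_diag G n \<Gamma> g \<chi> = mat_diag n
     (\<lambda>i. if i = 0 then 1 else inverse (\<chi> (universal_deg G (UT n) \<Gamma> (inv\<^bsub>G\<^esub> (g i)))))"

end

theory Submission
  imports Defs "Jordan_Normal_Form.Determinant"
begin

text \<open>
  Write \<open>e\<^sub>i\<^sub>j\<close> for the matrix units and \<open>deg i j\<close> for the degree of \<open>e\<^sub>i\<^sub>j\<close>.  Since the matrix units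
  are homogeneous and span \<open>UT\<^sub>n\<close>, the component of degree \<open>h\<close> consists of the matrices whose
  nonzero entries all sit at positions of degree \<open>h\<close> (\<open>component_iff\<close>).  The degree of \<open>e\<^sub>i\<^sub>i\<close> is the
  neutral element, so the identity matrix and every diagonal matrix have neutral degree.

  The centre of the argument is an explicit form of the fact that every automorphism \<open>f\<close> of \<open>UT\<^sub>n\<close>
  is inner (\<open>UT_aut_inner\<close>).  The matrices \<open>f(e\<^sub>i\<^sub>i)\<close> are nonzero orthogonal idempotents, and because
  \<open>e\<^sub>j\<^sub>j UT\<^sub>n e\<^sub>i\<^sub>i = 0\<close> for \<open>i < j\<close> they cannot be permuted modulo the strictly upper triangular
  matrices: the diagonal of \<open>f(e\<^sub>i\<^sub>i)\<close> has a \<open>1\<close> at position \<open>i\<close> (\<open>UT_aut_diag_entry\<close>).  Hence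
  \<open>a = \<Sum>\<^sub>i f(e\<^sub>i\<^sub>i) e\<^sub>i\<^sub>i\<close> has ones on its diagonal, so it is invertible, and
  \<open>f(e\<^sub>i\<^sub>i) a = a e\<^sub>i\<^sub>i\<close>.  After conjugating back by \<open>a\<close> the automorphism fixes every \<open>e\<^sub>i\<^sub>i\<close>, so it scales each
  \<open>e\<^sub>i\<^sub>j\<close> by some \<open>c\<^sub>i\<^sub>j\<close> with \<open>c\<^sub>i\<^sub>j c\<^sub>j\<^sub>k = c\<^sub>i\<^sub>k\<close>; this is conjugation by a diagonal matrix
  \<open>d\<close> (\<open>fixing_aut_eq_conj_diag\<close>).  Thus \<open>f\<close> is conjugation by \<open>a d\<close>.

  If \<open>f\<close> is a self-equivalence of the grading, then it maps the neutral component to the only component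
  that contains the identity matrix, which is the neutral component itself.  So each \<open>f(e\<^sub>i\<^sub>i)\<close> has
  neutral degree, and so have \<open>a\<close> and \<open>a d\<close>.  Conversely the inverse of a unit of neutral degree again
  has neutral degree, and therefore conjugation by such a unit preserves every component.  This gives
  \<open>Aut(\<Gamma>) = Stab(\<Gamma>)\<close> with the stated description, and the Weyl group is a group modulo itself.

  A diagonal automorphism scales the component of degree \<open>h\<close> by some \<open>\<phi>(h)\<close>.  Multiplicativity implies
  that \<open>\<phi>\<close> respects the defining relations of the universal group, so \<open>\<phi>\<close> extends to a
  character \<open>\<chi>\<close>, and since the automorphism fixes every \<open>e\<^sub>i\<^sub>i\<close>, it is conjugation by the matrix
  \<open>d\<close> above, whose entries are the values of \<open>\<chi>\<close> in question.  Conversely the relation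
  \<open>e\<^sub>0\<^sub>i e\<^sub>i\<^sub>j = e\<^sub>0\<^sub>j\<close> turns the ratios of the entries of \<open>diag(1, \<chi>(g\<^sub>1), \<dots>)\<close> into values of \<open>\<chi>\<close> on
  degrees.
\<close>

section \<open>The algebra of upper triangular matrices\<close>

lemma UT_sel [simp]:
  "x \<otimes>\<^bsub>UT n\<^esub> y = x * y" "\<one>\<^bsub>UT n\<^esub> = 1\<^sub>m n" "\<zero>\<^bsub>UT n\<^esub> = 0\<^sub>m n n"
  "x \<oplus>\<^bsub>UT n\<^esub> y = x + y" "c \<odot>\<^bsub>UT n\<^esub> x = c \<cdot>\<^sub>m x"
  by (simp_all add: UT_def module_mat_def)

lemma carrier_UT_iff:
  "x \<in> carrier (UT n) \<longleftrightarrow> x \<in> carrier_mat n n \<and> (\<forall>i<n. \<forall>j<i. x $$ (i, j) = 0)"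
  by (auto simp: UT_def module_mat_def upper_triangular_def)

lemma UT_carrier_mat: "x \<in> carrier (UT n) \<Longrightarrow> x \<in> carrier_mat n n"
  by (simp add: carrier_UT_iff)

lemma UT_lower_entry: "x \<in> carrier (UT n) \<Longrightarrow> i < n \<Longrightarrow> j < i \<Longrightarrow> x $$ (i, j) = 0"
  by (simp add: carrier_UT_iff)

lemma UT_eqI:
  assumes "x \<in> carrier (UT n)" "y \<in> carrier (UT n)"
    and "\<And>i j. i \<le> j \<Longrightarrow> j < n \<Longrightarrow> x $$ (i, j) = y $$ (i, j)"
  shows "x = y"
proof (rule eq_matI)
  fix i j assume "i < dim_row y" "j < dim_col y"
  with assms show "x $$ (i, j) = y $$ (i, j)"
    by (cases "i \<le> j") (auto simp: carrier_UT_iff)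
qed (use assms in \<open>auto simp: carrier_UT_iff\<close>)

lemma mult_entry:
  assumes "x \<in> carrier_mat n n" "y \<in> carrier_mat n n" "i < n" "j < n"
  shows "(x * y) $$ (i, j) = (\<Sum>k<n. x $$ (i, k) * y $$ (k, j))"
  using assms by (auto simp: scalar_prod_def atLeast0LessThan intro!: sum.cong)

lemma UT_mult_closed:
  assumes "x \<in> carrier (UT n)" "y \<in> carrier (UT n)"
  shows "x * y \<in> carrier (UT n)"
proof -
  have "(x * y) $$ (i, j) = 0" if "i < n" "j < i" for i j
  proof -
    have "x $$ (i, k) * y $$ (k, j) = 0" if "k < n" for k
      using assms \<open>i < n\<close> \<open>j < i\<close> that by (cases "k < i") (auto simp: carrier_UT_iff)
    then show ?thesis
      using assms that by (subst mult_entry[of x n y]) (auto simp: carrier_UT_iff intro!: sum.neutral)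
  qed
  moreover have "x * y \<in> carrier_mat n n"
    using assms by (auto simp: carrier_UT_iff)
  ultimately show ?thesis unfolding carrier_UT_iff by blast
qed

text \<open>
  Taking the diagonal is multiplicative: this is the quotient map modulo the strictly upper
  triangular matrices.
\<close>

lemma UT_mult_diag_entry:
  assumes "x \<in> carrier (UT n)" "y \<in> carrier (UT n)" "i < n"
  shows "(x * y) $$ (i, i) = x $$ (i, i) * y $$ (i, i)"
proof -
  have summand: "x $$ (i, k) * y $$ (k, i) = (if k = i then x $$ (i, i) * y $$ (i, i) else 0)"
    if "k < n" for k
  proof (cases k i rule: linorder_cases)
    case less
    with UT_lower_entry[OF assms(1,3)] show ?thesis by simp
  next
    case greater
    with UT_lower_entry[OF assms(2) \<open>k < n\<close>] show ?thesis by simp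
  qed simp
  have "(\<Sum>k<n. x $$ (i, k) * y $$ (k, i)) = (\<Sum>k<n. if k = i then x $$ (i, i) * y $$ (i, i) else 0)"
    by (rule sum.cong[OF HOL.refl], rule summand, simp)
  with assms show ?thesis
    using mult_entry[of x n y i i] by (simp add: UT_carrier_mat)
qed

lemma UT_one_closed: "1\<^sub>m n \<in> carrier (UT n)"
  by (auto simp: carrier_UT_iff)

lemma ring_UT: "ring (UT n :: ('k::field, 'k mat) module)"
proof (rule ringI)
  let ?A = "UT n :: ('k, 'k mat) module"
  show "abelian_group ?A"
  proof (rule abelian_groupI)
    fix x assume "x \<in> carrier ?A"
    then show "\<exists>y\<in>carrier ?A. y \<oplus>\<^bsub>?A\<^esub> x = \<zero>\<^bsub>?A\<^esub>"
      by (intro bexI[of _ "- x"]) (auto simp: carrier_UT_iff)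
  qed (auto simp: carrier_UT_iff intro: comm_add_mat)
  show "monoid ?A"
    by (rule monoidI)
      (auto simp: UT_mult_closed UT_one_closed dest!: UT_carrier_mat intro: assoc_mult_mat)
qed (auto simp: carrier_UT_iff add_mult_distrib_mat mult_add_distrib_mat)

lemma UT_smult_closed: "x \<in> carrier (UT n) \<Longrightarrow> c \<cdot>\<^sub>m x \<in> carrier (UT n)"
  by (auto simp: carrier_UT_iff)

lemma UT_zero_closed: "0\<^sub>m n n \<in> carrier (UT n)"
  by (auto simp: carrier_UT_iff)

lemma monoid_UT: "monoid (UT n :: ('k::field, 'k mat) module)"
  using ring_UT ring_def by blast

lemma UT_finsum_entry:
  assumes "finite F" "\<And>h. h \<in> F \<Longrightarrow> f h \<in> carrier (UT n)" "i < n" "j < n"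
  shows "(\<Oplus>\<^bsub>UT n\<^esub>h\<in>F. f h) $$ (i, j) = (\<Sum>h\<in>F. f h $$ (i, j))"
proof -
  interpret ring "UT n" by (rule ring_UT)
  from assms(1,2) show ?thesis
  proof (induction F)
    case empty
    then show ?case using assms(3,4) by simp
  next
    case (insert h F)
    then have "f \<in> F \<rightarrow> carrier (UT n)" "f h \<in> carrier (UT n)" by auto
    with insert have eq: "(\<Oplus>\<^bsub>UT n\<^esub>h\<in>insert h F. f h) = f h + (\<Oplus>\<^bsub>UT n\<^esub>h\<in>F. f h)"
      by (simp add: finsum_insert)
    have "(\<Oplus>\<^bsub>UT n\<^esub>h\<in>F. f h) \<in> carrier_mat n n"
      using \<open>f \<in> F \<rightarrow> carrier (UT n)\<close> by (intro UT_carrier_mat finsum_closed)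
    then show ?case unfolding eq using insert assms(3,4) by auto
  qed
qed

text \<open>
  The condition on the diagonal gives an inverse among all square matrices.  That this inverse is
  again upper triangular follows column by column, from the bottom row upwards: below the
  diagonal, an entry of \<open>a b = 1\<close> reduces to the single term \<open>a\<^sub>i\<^sub>i b\<^sub>i\<^sub>j\<close>.
\<close>

lemma Units_UT_iff:
  fixes a :: "'k::field mat"
  assumes "a \<in> carrier (UT n)"
  shows "a \<in> Units (UT n) \<longleftrightarrow> (\<forall>i<n. a $$ (i, i) \<noteq> 0)"
proof
  assume "a \<in> Units (UT n)"
  then obtain b where b: "b \<in> carrier (UT n)" "a * b = 1\<^sub>m n" by (auto simp: Units_def)
  show "\<forall>i<n. a $$ (i, i) \<noteq> 0"
    using UT_mult_diag_entry[OF assms b(1)] unfolding b(2) by fastforce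
next
  assume nz: "\<forall>i<n. a $$ (i, i) \<noteq> 0"
  have a: "a \<in> carrier_mat n n" "upper_triangular a"
    using assms by (auto simp: carrier_UT_iff)
  have "det a \<noteq> 0"
    using upper_triangular_imp_det_eq_0_iff[OF a] a nz by (auto simp: diag_mat_def)
  from det_non_zero_imp_unit[OF a(1) this, of "()"]
  obtain b where b: "b \<in> carrier_mat n n" "a * b = 1\<^sub>m n" "b * a = 1\<^sub>m n"
    by (auto simp: Units_def ring_mat_def)
  have "b $$ (i, j) = 0" if "j < i" "i < n" for i j
    using that
  proof (induction "n - i" arbitrary: i rule: less_induct)
    case less
    have summand: "a $$ (i, k) * b $$ (k, j) = (if k = i then a $$ (i, i) * b $$ (i, j) else 0)"
      if "k < n" for k
    proof (cases k i rule: linorder_cases)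
      case less
      with UT_lower_entry[OF assms \<open>i < n\<close>] show ?thesis by simp
    next
      case greater
      with less.hyps[of k] less.prems that show ?thesis by simp
    qed simp
    have "(\<Sum>k<n. a $$ (i, k) * b $$ (k, j)) = (\<Sum>k<n. if k = i then a $$ (i, i) * b $$ (i, j) else 0)"
      by (rule sum.cong[OF HOL.refl], rule summand, simp)
    then have "(a * b) $$ (i, j) = a $$ (i, i) * b $$ (i, j)"
      using mult_entry[OF a(1) b(1), of i j] less.prems by simp
    with b nz less.prems show ?case by auto
  qed
  with b have "b \<in> carrier (UT n)" by (auto simp: carrier_UT_iff)
  with b assms show "a \<in> Units (UT n)" by (auto simp: Units_def)
qed

lemma e_unit_entry [simp]:
  "k < n \<Longrightarrow> l < n \<Longrightarrow> e_unit n i j $$ (k, l) = (if k = i \<and> l = j then 1 else 0)"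
  by (simp add: e_unit_def)

lemma e_unit_closed: "i \<le> j \<Longrightarrow> e_unit n i j \<in> carrier (UT n)"
  by (auto simp: carrier_UT_iff e_unit_def)

lemma e_unit_carrier_mat [simp]:
  "e_unit n i j \<in> carrier_mat n n" "dim_row (e_unit n i j) = n" "dim_col (e_unit n i j) = n"
  by (simp_all add: e_unit_def)

lemma e_unit_nonzero:
  assumes "i < n" "j < n"
  shows "e_unit n i j \<noteq> (0\<^sub>m n n :: 'k::field mat)"
proof
  assume "e_unit n i j = (0\<^sub>m n n :: 'k mat)"
  then have "e_unit n i j $$ (i, j) = (0\<^sub>m n n :: 'k mat) $$ (i, j)" by simp
  with assms show False by simp
qed

lemma e_unit_mult_left_entry:
  assumes "x \<in> carrier_mat n n" "j < n" "k < n" "l < n"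
  shows "(e_unit n i j * x) $$ (k, l) = (if k = i then x $$ (j, l) else 0)"
proof -
  have "(e_unit n i j * x) $$ (k, l) = (\<Sum>m<n. if m = j then (if k = i then x $$ (j, l) else 0) else 0)"
    unfolding mult_entry[OF e_unit_carrier_mat(1) assms(1) assms(3,4)]
    by (rule sum.cong) (use assms in auto)
  with assms show ?thesis by simp
qed

lemma e_unit_mult_right_entry:
  assumes "x \<in> carrier_mat n n" "i < n" "k < n" "l < n"
  shows "(x * e_unit n i j) $$ (k, l) = (if l = j then x $$ (k, i) else 0)"
proof -
  have "(x * e_unit n i j) $$ (k, l) = (\<Sum>m<n. if m = i then (if l = j then x $$ (k, i) else 0) else 0)"
    unfolding mult_entry[OF assms(1) e_unit_carrier_mat(1) assms(3,4)]
    by (rule sum.cong) (use assms in auto)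
  with assms show ?thesis by simp
qed

lemma e_unit_mult:
  assumes "j < n" "k < n"
  shows "e_unit n i j * e_unit n k l = (if j = k then e_unit n i l else 0\<^sub>m n n)"
  using assms by (intro eq_matI) (auto simp: e_unit_mult_left_entry[OF e_unit_carrier_mat(1)] simp del: index_mult_mat(1))

text \<open>
  A strictly upper triangular matrix is nilpotent, and a nilpotent idempotent is zero.  Concretely,
  the entries of \<open>x x = x\<close> vanish by induction on their distance from the diagonal.
\<close>

lemma idempotent_zero_diag:
  fixes x :: "'k::field mat"
  assumes x: "x \<in> carrier (UT n)" "x * x = x" and diag: "\<And>i. i < n \<Longrightarrow> x $$ (i, i) = 0"
  shows "x = 0\<^sub>m n n"
proof (rule UT_eqI[OF x(1)])
  show "0\<^sub>m n n \<in> carrier (UT n)" by (simp add: carrier_UT_iff)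
  fix i j :: nat assume "i \<le> j" "j < n"
  have "x $$ (i, j) = 0"
    using \<open>i \<le> j\<close> \<open>j < n\<close>
  proof (induction "j - i" arbitrary: i j rule: less_induct)
    case less
    have "x $$ (i, k) * x $$ (k, j) = 0" if "k < n" for k
    proof (cases "i < k \<and> k < j")
      case True
      then show ?thesis using less.hyps[of k i] less.prems that by auto
    next
      case False
      then show ?thesis using less.prems that x(1) diag
        by (cases "k = i"; cases "k = j") (auto simp: carrier_UT_iff not_less)
    qed
    then have "(x * x) $$ (i, j) = 0"
      using less.prems x(1)
      by (subst mult_entry[of x n x]) (auto simp: carrier_UT_iff simp del: mult_eq_0_iff)
    then show ?case by (simp add: x(2))
  qed
  with \<open>i \<le> j\<close> \<open>j < n\<close> show "x $$ (i, j) = 0\<^sub>m n n $$ (i, j)" by simp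
qed

section \<open>Homomorphisms out of a presented group\<close>

definition word_eval :: "('h, 'm) monoid_scheme \<Rightarrow> ('s \<Rightarrow> 'h) \<Rightarrow> 's word \<Rightarrow> 'h" where
  "word_eval H \<phi> u =
     foldr (\<lambda>(x, b) y. (if b then \<phi> x else inv\<^bsub>H\<^esub> (\<phi> x)) \<otimes>\<^bsub>H\<^esub> y) u \<one>\<^bsub>H\<^esub>"

lemma (in group) word_eval_closed:
  assumes "\<phi> \<in> S \<rightarrow> carrier G" "u \<in> group_words S"
  shows "word_eval G \<phi> u \<in> carrier G"
  using assms(2) by (induction u) (use assms(1) in \<open>auto simp: word_eval_def group_words_def dest: funcset_mem\<close>)

lemma (in group) word_eval_append:
  assumes "\<phi> \<in> S \<rightarrow> carrier G" "u \<in> group_words S" "v \<in> group_words S"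
  shows "word_eval G \<phi> (u @ v) = word_eval G \<phi> u \<otimes> word_eval G \<phi> v"
  using assms(2)
proof (induction u)
  case Nil
  then show ?case using word_eval_closed[OF assms(1,3)] by (simp add: word_eval_def)
next
  case (Cons p u)
  obtain x b where p: "p = (x, b)" by (cases p)
  with Cons.prems have x: "\<phi> x \<in> carrier G" and u: "u \<in> group_words S"
    using assms(1) by (auto simp: group_words_def)
  have "word_eval G \<phi> ((p # u) @ v) = (if b then \<phi> x else inv \<phi> x) \<otimes> word_eval G \<phi> (u @ v)"
    by (simp add: word_eval_def p)
  also have "\<dots> = (if b then \<phi> x else inv \<phi> x) \<otimes> (word_eval G \<phi> u \<otimes> word_eval G \<phi> v)"
    using Cons.IH[OF u] by simp
  also have "\<dots> = (if b then \<phi> x else inv \<phi> x) \<otimes> word_eval G \<phi> u \<otimes> word_eval G \<phi> v"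
    using x word_eval_closed[OF assms(1) u] word_eval_closed[OF assms(1,3)]
    by (simp add: m_assoc)
  also have "(if b then \<phi> x else inv \<phi> x) \<otimes> word_eval G \<phi> u = word_eval G \<phi> (p # u)"
    by (simp add: word_eval_def p)
  finally show ?case .
qed

lemma (in group) word_eval_pres_rel:
  assumes \<phi>: "\<phi> \<in> S \<rightarrow> carrier G"
    and rels: "\<And>l r. (l, r) \<in> R \<Longrightarrow> word_eval G \<phi> l = word_eval G \<phi> r"
    and "(u, v) \<in> pres_rel S R"
  shows "word_eval G \<phi> u = word_eval G \<phi> v"
  using assms(3)
proof (induction rule: pres_rel.induct)
  case (cancel u v x b)
  have w: "[(x, b), (x, \<not> b)] \<in> group_words S"
    using cancel by (simp add: group_words_def)
  have "\<phi> x \<in> carrier G" using \<phi> cancel by auto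
  then have "word_eval G \<phi> [(x, b), (x, \<not> b)] = \<one>"
    by (cases b) (simp_all add: word_eval_def)
  then have "word_eval G \<phi> ([(x, b), (x, \<not> b)] @ v) = word_eval G \<phi> v"
    using word_eval_append[OF \<phi> w cancel(2)] word_eval_closed[OF \<phi> cancel(2)] by simp
  moreover have "[(x, b), (x, \<not> b)] @ v \<in> group_words S"
    using cancel w by (simp add: group_words_def)
  ultimately show ?case
    using word_eval_append[OF \<phi> cancel(1)] cancel(2) by metis
next
  case (rel u v l r)
  then have "l @ v \<in> group_words S" "r @ v \<in> group_words S"
    by (simp_all add: group_words_def)
  then show ?case
    using rel rels[OF rel(3)] by (simp add: word_eval_append[OF \<phi>])
qed simp_all

text \<open>
  The universal property of a group given by generators and relations.  Evaluation of words is
  constant on equivalence classes, so it does not matter which representative is chosen.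
\<close>

theorem (in group) presented_group_hom_exists:
  assumes \<phi>: "\<phi> \<in> S \<rightarrow> carrier G"
    and rels: "\<And>l r. (l, r) \<in> R \<Longrightarrow> word_eval G \<phi> l = word_eval G \<phi> r"
  obtains \<chi> where "\<chi> \<in> hom (presented_group S R) G"
    and "\<And>x. x \<in> S \<Longrightarrow> \<chi> (pres_gen S R x) = \<phi> x"
proof -
  define \<chi> where "\<chi> X = word_eval G \<phi> (SOME u. u \<in> X)" for X
  have \<chi>: "\<chi> (pres_rel S R `` {u}) = word_eval G \<phi> u" if "u \<in> group_words S" for u
  proof -
    have "(SOME v. v \<in> pres_rel S R `` {u}) \<in> pres_rel S R `` {u}"
      by (rule someI[of _ u]) (simp add: pres_rel.refl that)
    then show ?thesis
      unfolding \<chi>_def using word_eval_pres_rel[OF \<phi> rels] by simp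
  qed
  have car: "X \<in> carrier (presented_group S R) \<longleftrightarrow> (\<exists>u\<in>group_words S. X = pres_rel S R `` {u})"
    for X by (auto simp: presented_group_def quotient_def)
  have "\<chi> \<in> hom (presented_group S R) G"
  proof (rule homI)
    fix X assume "X \<in> carrier (presented_group S R)"
    then obtain u where u: "u \<in> group_words S" "X = pres_rel S R `` {u}" using car by blast
    then show "\<chi> X \<in> carrier G" using \<chi> word_eval_closed[OF \<phi>] by simp
    fix Y assume "Y \<in> carrier (presented_group S R)"
    then obtain v where v: "v \<in> group_words S" "Y = pres_rel S R `` {v}" using car by blast
    have "u @ v \<in> group_words S" using u v by (simp add: group_words_def)
    then show "\<chi> (X \<otimes>\<^bsub>presented_group S R\<^esub> Y) = \<chi> X \<otimes> \<chi> Y"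
      using u v by (simp add: presented_group_mult \<chi> word_eval_append[OF \<phi>])
  qed
  moreover have "\<chi> (pres_gen S R x) = \<phi> x" if "x \<in> S" for x
  proof -
    have "\<phi> x \<in> carrier G" using that \<phi> by auto
    moreover have "[(x, True)] \<in> group_words S" using that by (simp add: group_words_def)
    ultimately show ?thesis by (simp add: pres_gen_def \<chi> word_eval_def)
  qed
  ultimately show ?thesis using that by blast
qed

lemma presented_group_gen_mult:
  assumes "([(b, True), (c, True)], [(a, True)]) \<in> R" "a \<in> S" "b \<in> S" "c \<in> S"
  shows "pres_gen S R b \<otimes>\<^bsub>presented_group S R\<^esub> pres_gen S R c = pres_gen S R a"
proof -
  have "([(b, True), (c, True)], [(a, True)]) \<in> pres_rel S R"
    using pres_rel.rel[of "[]" S "[]", OF _ _ assms(1)] assms(2-4) by (simp add: group_words_def)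
  from equiv_class_eq[OF equiv_pres_rel this] show ?thesis
    using presented_group_mult[of "[(b, True)]" S "[(c, True)]" R] assms(2-4)
    by (simp add: pres_gen_def group_words_def)
qed

lemma pres_gen_closed: "x \<in> S \<Longrightarrow> pres_gen S R x \<in> carrier (presented_group S R)"
  by (auto simp: presented_group_def pres_gen_def group_words_def intro!: quotientI)

lemma field_units_sel [simp]:
  "carrier field_units = UNIV - {0}" "x \<otimes>\<^bsub>field_units\<^esub> y = x * y" "\<one>\<^bsub>field_units\<^esub> = 1"
  by (simp_all add: field_units_def)

lemma group_field_units: "group (field_units :: 'k::field monoid)"
proof (rule groupI)
  fix x :: 'k assume "x \<in> carrier field_units"
  then show "\<exists>y\<in>carrier field_units. y \<otimes>\<^bsub>field_units\<^esub> x = \<one>\<^bsub>field_units\<^esub>"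
    by (intro bexI[of _ "inverse x"]) auto
qed auto

section \<open>Conjugation by units\<close>

lemma (in monoid) inv_mult_Units:
  assumes "a \<in> Units G" "b \<in> Units G"
  shows "inv (a \<otimes> b) = inv b \<otimes> inv a"
proof (rule inv_char)
  have c: "a \<in> carrier G" "b \<in> carrier G" "inv a \<in> carrier G" "inv b \<in> carrier G"
    using assms by auto
  have "a \<otimes> b \<otimes> (inv b \<otimes> inv a) = a \<otimes> (b \<otimes> inv b) \<otimes> inv a"
    using c by (simp add: m_assoc del: Units_r_inv)
  then show "a \<otimes> b \<otimes> (inv b \<otimes> inv a) = \<one>" using assms c by simp
  have "inv b \<otimes> inv a \<otimes> (a \<otimes> b) = inv b \<otimes> (inv a \<otimes> a) \<otimes> b"
    using c by (simp add: m_assoc del: Units_l_inv)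
  then show "inv b \<otimes> inv a \<otimes> (a \<otimes> b) = \<one>" using assms c by simp
qed (use assms in auto)

lemma (in monoid) conj_mult:
  assumes "a \<in> Units G" "x \<in> carrier G" "y \<in> carrier G"
  shows "(a \<otimes> x \<otimes> inv a) \<otimes> (a \<otimes> y \<otimes> inv a) = a \<otimes> (x \<otimes> y) \<otimes> inv a"
proof -
  have c: "a \<in> carrier G" "inv a \<in> carrier G" using assms by auto
  have "(a \<otimes> x \<otimes> inv a) \<otimes> (a \<otimes> y \<otimes> inv a) = a \<otimes> x \<otimes> (inv a \<otimes> a) \<otimes> y \<otimes> inv a"
    using c assms by (simp add: m_assoc del: Units_l_inv)
  with c assms show ?thesis by (simp add: m_assoc)
qed

lemma (in monoid) conj_conj:
  assumes "a \<in> Units G" "b \<in> Units G" "x \<in> carrier G"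
  shows "a \<otimes> (b \<otimes> x \<otimes> inv b) \<otimes> inv a = (a \<otimes> b) \<otimes> x \<otimes> inv (a \<otimes> b)"
proof -
  have c: "a \<in> carrier G" "b \<in> carrier G" "inv a \<in> carrier G" "inv b \<in> carrier G"
    using assms by auto
  then show ?thesis using assms by (simp add: inv_mult_Units m_assoc)
qed

context
  fixes n :: nat and a :: "'k::field mat"
  assumes a: "a \<in> Units (UT n)"
begin

lemma Units_UT_closed: "a \<in> carrier (UT n)" "inv\<^bsub>UT n\<^esub> a \<in> carrier (UT n)"
  using a monoid.Units_closed[OF monoid_UT] monoid.Units_inv_closed[OF monoid_UT] by auto

lemma Units_UT_inv: "inv\<^bsub>UT n\<^esub> a \<in> Units (UT n)"
  "a * inv\<^bsub>UT n\<^esub> a = 1\<^sub>m n" "inv\<^bsub>UT n\<^esub> a * a = 1\<^sub>m n"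
  using a monoid.Units_inv_Units[OF monoid_UT] monoid.Units_r_inv[OF monoid_UT a]
    monoid.Units_l_inv[OF monoid_UT a] by auto

lemma conj_map_apply: "x \<in> carrier (UT n) \<Longrightarrow> conj_map n a x = a * x * inv\<^bsub>UT n\<^esub> a"
  by (simp add: conj_map_def)

lemma conj_map_closed: "x \<in> carrier (UT n) \<Longrightarrow> conj_map n a x \<in> carrier (UT n)"
  using Units_UT_closed by (simp add: conj_map_apply UT_mult_closed)

lemma conj_map_conj_map:
  assumes "b \<in> Units (UT n)" "x \<in> carrier (UT n)"
  shows "conj_map n a (conj_map n b x) = conj_map n (a * b) x"
  using monoid.conj_conj[OF monoid_UT a assms] assms a
    monoid.Units_closed[OF monoid_UT assms(1)] monoid.Units_inv_closed[OF monoid_UT assms(1)]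
  by (simp add: conj_map_def UT_mult_closed)

end

lemma Units_UT_mult: "a \<in> Units (UT n) \<Longrightarrow> b \<in> Units (UT n) \<Longrightarrow> a * b \<in> Units (UT n)"
  using monoid.Units_m_closed[OF monoid_UT, of a n b] by simp

lemma conj_map_one: "(x :: 'k::field mat) \<in> carrier (UT n) \<Longrightarrow> conj_map n (1\<^sub>m n) x = x"
  using monoid.inv_one[OF monoid_UT[where 'k = 'k], of n] UT_carrier_mat[of x n] by (simp add: conj_map_def)

lemma conj_map_inverse:
  assumes "a \<in> Units (UT n)" "x \<in> carrier (UT n)"
  shows "conj_map n a (conj_map n (inv\<^bsub>UT n\<^esub> a) x) = x"
    "conj_map n (inv\<^bsub>UT n\<^esub> a) (conj_map n a x) = x"
  using assms Units_UT_inv[OF assms(1)] by (simp_all add: conj_map_conj_map conj_map_one)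

lemma conj_map_algebra_aut:
  fixes a :: "'k::field mat"
  assumes a: "a \<in> Units (UT n)"
  shows "conj_map n a \<in> algebra_aut (UT n)"
proof -
  note cl = Units_UT_closed[OF a] Units_UT_closed[OF a, THEN UT_carrier_mat]
  have bij: "bij_betw (conj_map n a) (carrier (UT n)) (carrier (UT n))"
    by (rule bij_betwI[where g = "conj_map n (inv\<^bsub>UT n\<^esub> a)"])
      (use a Units_UT_inv(1)[OF a] in \<open>auto simp: conj_map_closed conj_map_inverse\<close>)
  have hom: "conj_map n a \<in> ring_hom (UT n) (UT n)"
  proof (rule ring_hom_memI)
    fix x y :: "'k mat" assume xy: "x \<in> carrier (UT n)" "y \<in> carrier (UT n)"
    note xy' = xy[THEN UT_carrier_mat]
    show "conj_map n a x \<in> carrier (UT n)" using a xy by (simp add: conj_map_closed)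
    show "conj_map n a (x \<otimes>\<^bsub>UT n\<^esub> y) = conj_map n a x \<otimes>\<^bsub>UT n\<^esub> conj_map n a y"
      using monoid.conj_mult[OF monoid_UT a xy] xy a by (simp add: conj_map_apply UT_mult_closed)
    have "x + y \<in> carrier (UT n)" using xy by (auto simp: carrier_UT_iff)
    then show "conj_map n a (x \<oplus>\<^bsub>UT n\<^esub> y) = conj_map n a x \<oplus>\<^bsub>UT n\<^esub> conj_map n a y"
      using xy xy' cl a
      by (simp add: conj_map_apply mult_add_distrib_mat[of a n n] add_mult_distrib_mat[of _ n n])
  next
    show "conj_map n a \<one>\<^bsub>UT n\<^esub> = \<one>\<^bsub>UT n\<^esub>"
      using a cl Units_UT_inv[OF a] by (simp add: conj_map_apply UT_one_closed)
  qed
  have "conj_map n a (c \<cdot>\<^sub>m x) = c \<cdot>\<^sub>m conj_map n a x" if "x \<in> carrier (UT n)" for c :: 'k and x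
    using a that cl UT_carrier_mat[OF that]
    by (simp add: conj_map_apply UT_smult_closed mult_smult_distrib[of a n n] mult_smult_assoc_mat[of _ n n])
  with bij hom show ?thesis
    by (simp add: algebra_aut_def Bij_def conj_map_def)
qed

section \<open>Automorphisms of the algebra of upper triangular matrices\<close>

text \<open>
  Scalar multiplication has to be closed on the carrier by assumption, because a ring whose record
  happens to have a scalar multiplication need not be an algebra.
\<close>

lemma algebra_aut_compose:
  assumes f: "f \<in> algebra_aut A" and h: "h \<in> algebra_aut A" and A: "ring A" and
    sm: "\<And>c x. x \<in> carrier A \<Longrightarrow> c \<odot>\<^bsub>A\<^esub> x \<in> carrier A"
  shows "compose (carrier A) f h \<in> algebra_aut A"
proof -
  interpret ring A by (rule A)
  have car: "f x \<in> carrier A" "h x \<in> carrier A" if "x \<in> carrier A" for x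
    using f h that by (auto simp: algebra_aut_def ring_hom_def)
  have "compose (carrier A) f h \<in> Bij (carrier A)"
    using f h by (auto simp: algebra_aut_def intro: compose_Bij)
  moreover have "compose (carrier A) f h \<in> ring_hom A A"
    using f h car by (auto simp: algebra_aut_def ring_hom_def compose_def)
  ultimately show ?thesis
    using f h car sm by (simp add: algebra_aut_def compose_def)
qed

context
  fixes n :: nat and f :: "'k::field mat \<Rightarrow> 'k mat"
  assumes f: "f \<in> algebra_aut (UT n)"
begin

lemma UT_aut_closed: "x \<in> carrier (UT n) \<Longrightarrow> f x \<in> carrier (UT n)"
  and UT_aut_mult: "x \<in> carrier (UT n) \<Longrightarrow> y \<in> carrier (UT n) \<Longrightarrow> f (x * y) = f x * f y"
  and UT_aut_smult: "x \<in> carrier (UT n) \<Longrightarrow> f (c \<cdot>\<^sub>m x) = c \<cdot>\<^sub>m f x"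
  and UT_aut_one: "f (1\<^sub>m n) = 1\<^sub>m n"
  and UT_aut_inj: "inj_on f (carrier (UT n))"
  and UT_aut_surj: "f ` carrier (UT n) = carrier (UT n)"
  and UT_aut_ext: "f \<in> extensional (carrier (UT n))"
  using f by (auto simp: algebra_aut_def ring_hom_def Bij_def bij_betw_def)

lemma UT_aut_zero: "f (0\<^sub>m n n) = 0\<^sub>m n n"
proof -
  have "0\<^sub>m n n \<in> carrier (UT n)" by (auto simp: carrier_UT_iff)
  moreover from this have "0 \<cdot>\<^sub>m f (0\<^sub>m n n) = 0\<^sub>m n n"
    using UT_aut_closed UT_carrier_mat by (intro eq_matI) fastforce+
  ultimately show ?thesis using UT_aut_smult[of "0\<^sub>m n n" 0] by simp
qed

lemma UT_aut_nonzero: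
  assumes "x \<in> carrier (UT n)" "x \<noteq> 0\<^sub>m n n"
  shows "f x \<noteq> 0\<^sub>m n n"
proof
  assume "f x = 0\<^sub>m n n"
  moreover have "0\<^sub>m n n \<in> carrier (UT n)" by (auto simp: carrier_UT_iff)
  ultimately show False using UT_aut_zero UT_aut_inj assms by (metis inj_onD)
qed

lemma UT_aut_idempotent:
  assumes "i < n"
  shows "f (e_unit n i i) * f (e_unit n i i) = f (e_unit n i i)"
  using assms by (simp add: e_unit_closed e_unit_mult flip: UT_aut_mult)

lemma UT_aut_orthogonal:
  assumes "i < n" "j < n" "i \<noteq> j"
  shows "f (e_unit n i i) * f (e_unit n j j) = 0\<^sub>m n n"
  using assms by (simp add: e_unit_closed e_unit_mult UT_aut_zero flip: UT_aut_mult)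

text \<open>
  Modulo strictly upper triangular matrices an automorphism permutes the idempotents \<open>e\<^sub>i\<^sub>i\<close>, say by
  \<open>\<sigma>\<close>.  If \<open>i < j\<close> but \<open>\<sigma> j \<le> \<sigma> i\<close>, then \<open>f(e\<^sub>j\<^sub>j) e\<^sub>r\<^sub>s f(e\<^sub>i\<^sub>i)\<close> with \<open>r = \<sigma> j\<close> and
  \<open>s = \<sigma> i\<close> would be nonzero, whereas it is the image of an element of
  \<open>e\<^sub>j\<^sub>j UT\<^sub>n e\<^sub>i\<^sub>i = 0\<close>.  So \<open>\<sigma>\<close> is strictly increasing, and a strictly increasing map of \<open>{..<n}\<close> to itself is the identity.
\<close>

lemma UT_aut_diag_entry:
  assumes "i < n"
  shows "f (e_unit n i i) $$ (i, i) = 1"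
proof -
  define p where "p i = f (e_unit n i i)" for i
  have cl: "p i \<in> carrier (UT n)" for i by (simp add: p_def UT_aut_closed e_unit_closed)
  have idem: "p i * p i = p i" if "i < n" for i using that by (simp add: p_def UT_aut_idempotent)
  have one: "p i $$ (k, k) = 1" if "i < n" "k < n" "p i $$ (k, k) \<noteq> 0" for i k
    using UT_mult_diag_entry[OF cl cl, of k i i] idem that by simp
  have ex: "\<exists>k<n. p i $$ (k, k) \<noteq> 0" if "i < n" for i
  proof (rule ccontr)
    assume "\<not> ?thesis"
    then have "p i = 0\<^sub>m n n" using idempotent_zero_diag[OF cl idem] that by blast
    with UT_aut_nonzero[OF e_unit_closed e_unit_nonzero] that show False by (simp add: p_def)
  qed
  then obtain \<sigma> where \<sigma>: "\<And>i. i < n \<Longrightarrow> \<sigma> i < n \<and> p i $$ (\<sigma> i, \<sigma> i) \<noteq> 0" by metis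
  have mono: "\<sigma> i < \<sigma> j" if "i < j" "j < n" for i j
  proof (rule ccontr)
    assume "\<not> \<sigma> i < \<sigma> j"
    then have le: "\<sigma> j \<le> \<sigma> i" by simp
    obtain y where y: "y \<in> carrier (UT n)" "f y = e_unit n (\<sigma> j) (\<sigma> i)"
      using UT_aut_surj e_unit_closed[OF le] by (metis imageE)
    have "e_unit n j j * (y * e_unit n i i) = 0\<^sub>m n n"
    proof (rule eq_matI)
      fix k l assume kl: "k < dim_row (0\<^sub>m n n :: 'k mat)" "l < dim_col (0\<^sub>m n n :: 'k mat)"
      have "(e_unit n j j * (y * e_unit n i i)) $$ (k, l) = (if k = j \<and> l = i then y $$ (j, i) else 0)"
        using kl y that UT_carrier_mat[OF y(1)]
        by (subst e_unit_mult_left_entry) (auto simp: e_unit_mult_right_entry simp del: index_mult_mat(1))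
      then show "(e_unit n j j * (y * e_unit n i i)) $$ (k, l) = 0\<^sub>m n n $$ (k, l)"
        using UT_lower_entry[OF y(1), of j i] that kl by simp
    qed (use y in \<open>auto dest: UT_carrier_mat\<close>)
    then have "0\<^sub>m n n = p j * (e_unit n (\<sigma> j) (\<sigma> i) * p i)"
      using y that by (simp add: p_def e_unit_closed UT_mult_closed UT_aut_zero flip: UT_aut_mult y(2))
    then have "0 = (p j * (e_unit n (\<sigma> j) (\<sigma> i) * p i)) $$ (\<sigma> j, \<sigma> i)"
      using \<sigma> that by (metis index_zero_mat(1) order.strict_trans)
    also have "\<dots> = (\<Sum>k<n. if k = \<sigma> j then p j $$ (\<sigma> j, \<sigma> j) * p i $$ (\<sigma> i, \<sigma> i) else 0)"
      unfolding mult_entry[OF UT_carrier_mat[OF cl] UT_carrier_mat[OF UT_mult_closed[OF e_unit_closed[OF le] cl]]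
          conjunct1[OF \<sigma>[OF that(2)]] conjunct1[OF \<sigma>[OF order.strict_trans[OF that]]]]
      by (rule sum.cong[OF HOL.refl])
        (use \<sigma> that le in \<open>auto simp: e_unit_mult_left_entry[OF UT_carrier_mat[OF cl]] simp del: index_mult_mat(1)\<close>)
    also have "\<dots> = p j $$ (\<sigma> j, \<sigma> j) * p i $$ (\<sigma> i, \<sigma> i)" using \<sigma>[OF that(2)] by simp
    finally show False using \<sigma>[of i] \<sigma>[of j] that by simp
  qed
  \<comment> \<open>A strictly increasing map grows at least as fast as its argument; from \<open>0\<close> to \<open>i\<close> this gives
    \<open>i \<le> \<sigma> i\<close>, from \<open>i\<close> to \<open>n - 1\<close> it gives \<open>\<sigma> i \<le> i\<close>.\<close>
  have gap: "\<sigma> i + k \<le> \<sigma> (i + k)" if "i + k < n" for i k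
    using that
  proof (induction k)
    case (Suc k)
    then show ?case using mono[of "i + k" "i + Suc k"] by simp
  qed simp
  have "\<sigma> i = i"
    using gap[of 0 i] gap[of i "n - 1 - i"] \<sigma>[of "n - 1"] assms by (simp, arith)
  with one[OF assms assms] \<sigma>[OF assms] show ?thesis by (simp add: p_def)
qed

end

context
  fixes n :: nat and f :: "'k::field mat \<Rightarrow> 'k mat"
  assumes f: "f \<in> algebra_aut (UT n)"
    and fix_idem: "\<And>i. i < n \<Longrightarrow> f (e_unit n i i) = e_unit n i i"
begin

text \<open>
  An automorphism that fixes every \<open>e\<^sub>i\<^sub>i\<close> commutes with \<open>x \<mapsto> e\<^sub>i\<^sub>i x e\<^sub>j\<^sub>j\<close>, which cuts out the single
  entry at \<open>(i, j)\<close>; so it acts on entries one at a time.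
\<close>

lemma fixing_aut_entry:
  assumes x: "x \<in> carrier (UT n)" and ij: "i \<le> j" "j < n"
  shows "f x $$ (i, j) = x $$ (i, j) * f (e_unit n i j) $$ (i, j)"
proof -
  have "e_unit n i i * (x * e_unit n j j) = x $$ (i, j) \<cdot>\<^sub>m e_unit n i j"
    using ij UT_carrier_mat[OF x]
    by (intro eq_matI)
      (auto simp: e_unit_mult_left_entry e_unit_mult_right_entry simp del: index_mult_mat(1))
  then have "f (e_unit n i i * (x * e_unit n j j)) = x $$ (i, j) \<cdot>\<^sub>m f (e_unit n i j)"
    using ij by (simp add: UT_aut_smult[OF f] e_unit_closed)
  then have "e_unit n i i * (f x * e_unit n j j) = x $$ (i, j) \<cdot>\<^sub>m f (e_unit n i j)"
    using ij x by (simp add: UT_aut_mult[OF f] e_unit_closed UT_mult_closed fix_idem)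
  then have "(e_unit n i i * (f x * e_unit n j j)) $$ (i, j) = (x $$ (i, j) \<cdot>\<^sub>m f (e_unit n i j)) $$ (i, j)"
    by simp
  then show ?thesis
    using ij UT_carrier_mat[OF UT_aut_closed[OF f x]]
      UT_carrier_mat[OF UT_aut_closed[OF f e_unit_closed[OF ij(1)]]]
    by (simp add: e_unit_mult_left_entry e_unit_mult_right_entry del: index_mult_mat(1))
qed

lemma fixing_aut_coeff_nonzero:
  assumes ij: "i \<le> j" "j < n"
  shows "f (e_unit n i j) $$ (i, j) \<noteq> 0"
proof
  assume z: "f (e_unit n i j) $$ (i, j) = 0"
  have "f (e_unit n i j) = 0\<^sub>m n n"
  proof (rule UT_eqI)
    fix k l assume kl: "k \<le> l" "l < n"
    show "f (e_unit n i j) $$ (k, l) = 0\<^sub>m n n $$ (k, l)"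
      using fixing_aut_entry[OF e_unit_closed[OF ij(1)] kl] kl z by auto
  qed (use ij in \<open>simp_all add: UT_aut_closed[OF f] e_unit_closed UT_zero_closed\<close>)
  with UT_aut_nonzero[OF f e_unit_closed[OF ij(1)] e_unit_nonzero] ij show False by simp
qed

text \<open>
  The scaling factors form a cocycle, by \<open>e\<^sub>0\<^sub>i e\<^sub>i\<^sub>j = e\<^sub>0\<^sub>j\<close>; they are therefore determined by
  those of the first row.
\<close>

lemma fixing_aut_coeff_mult:
  assumes "i \<le> j" "j < n"
  shows "f (e_unit n 0 j) $$ (0, j) = f (e_unit n 0 i) $$ (0, i) * f (e_unit n i j) $$ (i, j)"
proof -
  have i: "0 < n" "i < n" using assms by auto
  note cl = UT_carrier_mat[OF UT_aut_closed[OF f e_unit_closed]]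
  have "f (e_unit n 0 j) = f (e_unit n 0 i) * f (e_unit n i j)"
    using assms by (simp add: e_unit_closed e_unit_mult flip: UT_aut_mult[OF f])
  also have "\<dots> $$ (0, j) = (\<Sum>k<n. f (e_unit n 0 i) $$ (0, k) * f (e_unit n i j) $$ (k, j))"
    by (rule mult_entry) (use cl assms i in auto)
  also have "\<dots> = (\<Sum>k<n. if k = i then f (e_unit n 0 i) $$ (0, i) * f (e_unit n i j) $$ (i, j) else 0)"
  proof (rule sum.cong[OF HOL.refl])
    fix k assume "k \<in> {..<n}"
    then have "f (e_unit n 0 i) $$ (0, k) = (if k = i then f (e_unit n 0 i) $$ (0, i) else 0)"
      using fixing_aut_entry[OF e_unit_closed[of 0 i], of 0 k] i by auto
    then show "f (e_unit n 0 i) $$ (0, k) * f (e_unit n i j) $$ (k, j) =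
      (if k = i then f (e_unit n 0 i) $$ (0, i) * f (e_unit n i j) $$ (i, j) else 0)" by simp
  qed
  finally show ?thesis using i by simp
qed

end

lemma mat_diag_Units:
  fixes d :: "nat \<Rightarrow> 'k::field"
  assumes "\<And>i. i < n \<Longrightarrow> d i \<noteq> 0"
  shows "mat_diag n d \<in> Units (UT n)" "inv\<^bsub>UT n\<^esub> (mat_diag n d) = mat_diag n (\<lambda>i. inverse (d i))"
proof -
  have cl: "mat_diag n h \<in> carrier (UT n)" for h :: "nat \<Rightarrow> 'k"
    by (auto simp: carrier_UT_iff mat_diag_def)
  have "mat_diag n (\<lambda>i. d i * inverse (d i)) = 1\<^sub>m n" "mat_diag n (\<lambda>i. inverse (d i) * d i) = 1\<^sub>m n"
    using assms by (auto simp: mat_diag_def)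
  then have inv: "mat_diag n d * mat_diag n (\<lambda>i. inverse (d i)) = 1\<^sub>m n"
    "mat_diag n (\<lambda>i. inverse (d i)) * mat_diag n d = 1\<^sub>m n"
    by simp_all
  then show "mat_diag n d \<in> Units (UT n)"
    using cl by (auto simp: Units_def intro!: bexI[of _ "mat_diag n (\<lambda>i. inverse (d i))"])
  show "inv\<^bsub>UT n\<^esub> (mat_diag n d) = mat_diag n (\<lambda>i. inverse (d i))"
    using monoid.inv_char[OF monoid_UT cl cl, of d] inv by simp
qed

lemma conj_map_mat_diag_entry:
  fixes d :: "nat \<Rightarrow> 'k::field"
  assumes "\<And>i. i < n \<Longrightarrow> d i \<noteq> 0" "x \<in> carrier (UT n)" "i < n" "j < n"
  shows "conj_map n (mat_diag n d) x $$ (i, j) = d i * x $$ (i, j) / d j"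
  using assms UT_carrier_mat[OF assms(2)]
  by (simp add: conj_map_apply mat_diag_Units mat_diag_mult_left[of _ n n]
      mat_diag_mult_right[of _ n n] divide_inverse)

lemma fixing_aut_eq_conj_diag:
  fixes f :: "'k::field mat \<Rightarrow> 'k mat"
  assumes f: "f \<in> algebra_aut (UT n)"
    and fix_idem: "\<And>i. i < n \<Longrightarrow> f (e_unit n i i) = e_unit n i i"
    and d: "\<And>i. i < n \<Longrightarrow> d i = inverse (f (e_unit n 0 i) $$ (0, i))"
  shows "f = conj_map n (mat_diag n d)"
proof (rule extensionalityI[of _ "carrier (UT n)"])
  note nz = fixing_aut_coeff_nonzero[OF f fix_idem, of 0]
  have d0: "d i \<noteq> 0" if "i < n" for i using nz[of i] d[of i] that by simp
  show "f \<in> extensional (carrier (UT n))" using UT_aut_ext[OF f] .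
  show "conj_map n (mat_diag n d) \<in> extensional (carrier (UT n))" by (simp add: conj_map_def)
  fix x :: "'k mat" assume x: "x \<in> carrier (UT n)"
  show "f x = conj_map n (mat_diag n d) x"
  proof (rule UT_eqI)
    fix i j assume ij: "i \<le> j" "j < n"
    have "f x $$ (i, j) = x $$ (i, j) * (f (e_unit n 0 j) $$ (0, j) / f (e_unit n 0 i) $$ (0, i))"
      using fixing_aut_entry[OF f fix_idem x ij] fixing_aut_coeff_mult[OF f fix_idem ij] nz[of i] ij
      by simp
    also have "\<dots> = d i * x $$ (i, j) / d j"
      using d[of i] d[of j] ij by (simp add: field_simps)
    also have "\<dots> = conj_map n (mat_diag n d) x $$ (i, j)"
      using conj_map_mat_diag_entry[of n d x i j] d0 x ij by simp
    finally show "f x $$ (i, j) = conj_map n (mat_diag n d) x $$ (i, j)" .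
  qed (use x UT_aut_closed[OF f] conj_map_closed[OF mat_diag_Units(1)] d0 in auto)
qed

text \<open>
  This is \<open>\<Sum>\<^sub>j f(e\<^sub>j\<^sub>j) e\<^sub>j\<^sub>j\<close>: its column \<open>j\<close> is column \<open>j\<close> of \<open>f(e\<^sub>j\<^sub>j)\<close>, an eigenvector of the
  idempotent \<open>f(e\<^sub>j\<^sub>j)\<close> for the eigenvalue \<open>1\<close>.
\<close>

definition idempotent_frame :: "nat \<Rightarrow> ('k::field mat \<Rightarrow> 'k mat) \<Rightarrow> 'k mat" where
  "idempotent_frame n f = Matrix.mat n n (\<lambda>(k, j). f (e_unit n j j) $$ (k, j))"

lemma idempotent_frame_Units:
  assumes "f \<in> algebra_aut (UT n)"
  shows "idempotent_frame n f \<in> Units (UT n)"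
proof -
  have "idempotent_frame n f \<in> carrier (UT n)"
    using UT_lower_entry[OF UT_aut_closed[OF assms e_unit_closed]]
    by (simp add: carrier_UT_iff idempotent_frame_def)
  then show ?thesis
    using UT_aut_diag_entry[OF assms] by (simp add: Units_UT_iff idempotent_frame_def)
qed

text \<open>
  By orthogonality \<open>f(e\<^sub>i\<^sub>i)\<close> kills every column of the frame other than column \<open>i\<close>, which it fixes;
  right multiplication by \<open>e\<^sub>i\<^sub>i\<close> has the same effect.
\<close>

lemma idempotent_frame_intertwines:
  assumes f: "f \<in> algebra_aut (UT n)" and i: "i < n"
  shows "f (e_unit n i i) * idempotent_frame n f = idempotent_frame n f * e_unit n i i"
proof (rule eq_matI)
  have a: "idempotent_frame n f \<in> carrier_mat n n" by (simp add: idempotent_frame_def)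
  note cl = UT_carrier_mat[OF UT_aut_closed[OF f e_unit_closed]]
  fix k l
  assume "k < dim_row (idempotent_frame n f * e_unit n i i)"
    "l < dim_col (idempotent_frame n f * e_unit n i i)"
  then have kl: "k < n" "l < n" using a by auto
  have "(f (e_unit n i i) * idempotent_frame n f) $$ (k, l) =
      (\<Sum>m<n. f (e_unit n i i) $$ (k, m) * f (e_unit n l l) $$ (m, l))"
    using mult_entry[OF cl a kl, of i i] kl by (simp add: idempotent_frame_def)
  also have "\<dots> = (f (e_unit n i i) * f (e_unit n l l)) $$ (k, l)"
    using mult_entry[OF cl cl kl, of i i l l] by simp
  also have "\<dots> = (if l = i then f (e_unit n i i) $$ (k, i) else 0)"
    using UT_aut_idempotent[OF f i] UT_aut_orthogonal[OF f i kl(2)] kl by auto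
  also have "\<dots> = (idempotent_frame n f * e_unit n i i) $$ (k, l)"
    using e_unit_mult_right_entry[OF a i kl] kl i
    by (simp add: idempotent_frame_def del: index_mult_mat(1))
  finally show "(f (e_unit n i i) * idempotent_frame n f) $$ (k, l) =
    (idempotent_frame n f * e_unit n i i) $$ (k, l)" .
qed (use UT_carrier_mat[OF UT_aut_closed[OF f e_unit_closed]] in \<open>auto simp: idempotent_frame_def\<close>)

text \<open>
  Conjugating back by the frame gives an automorphism that fixes every \<open>e\<^sub>i\<^sub>i\<close>, hence a conjugation
  by a diagonal matrix.  The conjugating matrix is stated explicitly because its entries are those
  of \<open>f(e\<^sub>j\<^sub>j)\<close> up to nonzero factors: this is how the degree of \<open>f(e\<^sub>j\<^sub>j)\<close> controls its degree.
\<close>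

theorem UT_aut_inner:
  fixes f :: "'k::field mat \<Rightarrow> 'k mat"
  assumes f: "f \<in> algebra_aut (UT n)"
  obtains d where "\<And>i. i < n \<Longrightarrow> d i \<noteq> 0"
    and "f = conj_map n (idempotent_frame n f * mat_diag n d)"
proof -
  define a where "a = idempotent_frame n f"
  define b where "b = inv\<^bsub>UT n\<^esub> a"
  define h where "h = compose (carrier (UT n)) (conj_map n b) f"
  have a: "a \<in> Units (UT n)" unfolding a_def by (rule idempotent_frame_Units[OF f])
  have b: "b \<in> Units (UT n)" "inv\<^bsub>UT n\<^esub> b = a" "b * a = 1\<^sub>m n"
    using Units_UT_inv[OF a] monoid.Units_inv_inv[OF monoid_UT a] by (simp_all add: b_def)
  note cm = Units_UT_closed(1)[OF a] Units_UT_closed(1)[OF b(1)]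
  have h_aut: "h \<in> algebra_aut (UT n)" unfolding h_def
    by (rule algebra_aut_compose[OF conj_map_algebra_aut[OF b(1)] f ring_UT])
      (simp add: UT_smult_closed)
  have h_fix: "h (e_unit n i i) = e_unit n i i" if "i < n" for i
  proof -
    have "h (e_unit n i i) = b * f (e_unit n i i) * a"
      using b UT_aut_closed[OF f] by (simp add: h_def compose_def e_unit_closed conj_map_apply)
    also have "\<dots> = b * (a * e_unit n i i)"
      using assoc_mult_mat[OF cm(2)[THEN UT_carrier_mat]
          UT_carrier_mat[OF UT_aut_closed[OF f e_unit_closed]] cm(1)[THEN UT_carrier_mat], of i i]
        idempotent_frame_intertwines[OF f that]
      by (simp add: a_def)
    also have "\<dots> = e_unit n i i"
      using assoc_mult_mat[OF cm(2,1)[THEN UT_carrier_mat] e_unit_carrier_mat(1), of i i] b(3)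
      by simp
    finally show ?thesis .
  qed
  define d where "d i = inverse (h (e_unit n 0 i) $$ (0, i))" for i
  have d: "d i \<noteq> 0" if "i < n" for i
    using fixing_aut_coeff_nonzero[OF h_aut h_fix, of 0 i] that by (simp add: d_def)
  have h: "h = conj_map n (mat_diag n d)"
    by (rule fixing_aut_eq_conj_diag[OF h_aut h_fix]) (simp_all add: d_def)
  have "f = conj_map n (a * mat_diag n d)"
  proof (rule extensionalityI[OF UT_aut_ext[OF f]])
    show "conj_map n (a * mat_diag n d) \<in> extensional (carrier (UT n))" by (simp add: conj_map_def)
    fix x :: "'k mat" assume x: "x \<in> carrier (UT n)"
    have "conj_map n (a * mat_diag n d) x = conj_map n a (h x)"
      using conj_map_conj_map[OF a mat_diag_Units(1) x] d by (simp add: h)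
    also have "\<dots> = f x"
      using x UT_aut_closed[OF f x] by (simp add: h_def compose_def b_def conj_map_inverse(1)[OF a])
    finally show "f x = conj_map n (a * mat_diag n d) x" by simp
  qed
  with d show ?thesis unfolding a_def by (rule that)
qed

section \<open>Components of an elementary grading\<close>

locale elementary_UT = group G for G (structure) +
  fixes n :: nat and \<Gamma> :: "'a \<Rightarrow> 'k::field mat set" and g :: "nat \<Rightarrow> 'a"
  assumes n_pos: "0 < n"
    and grading: "is_grading G (UT n) \<Gamma>"
    and g_closed: "i < n \<Longrightarrow> g i \<in> carrier G"
    and g_0: "g 0 = \<one>"
    and e_unit_homogeneous:
      "i \<le> j \<Longrightarrow> j < n \<Longrightarrow> homogeneous (UT n) \<Gamma> (g i \<otimes> inv (g j)) (e_unit n i j)"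
begin

definition deg :: "nat \<Rightarrow> nat \<Rightarrow> 'a" where
  "deg i j = g i \<otimes> inv (g j)"

lemma deg_closed: "i < n \<Longrightarrow> j < n \<Longrightarrow> deg i j \<in> carrier G"
  by (simp add: deg_def g_closed)

lemma deg_self: "i < n \<Longrightarrow> deg i i = \<one>"
  by (simp add: deg_def g_closed)

lemma deg_0: "j < n \<Longrightarrow> deg 0 j = inv (g j)"
  by (simp add: deg_def g_closed g_0)

lemma deg_mult: "i < n \<Longrightarrow> j < n \<Longrightarrow> k < n \<Longrightarrow> deg i j \<otimes> deg j k = deg i k"
  by (simp add: deg_def g_closed m_assoc inv_solve_left' flip: m_assoc[of "inv (g j)"])

definition degree_part :: "'a \<Rightarrow> 'k mat \<Rightarrow> 'k mat" where
  "degree_part h x = Matrix.mat n n (\<lambda>(i, j). if deg i j = h then x $$ (i, j) else 0)"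

lemma degree_part_entry [simp]:
  "i < n \<Longrightarrow> j < n \<Longrightarrow> degree_part h x $$ (i, j) = (if deg i j = h then x $$ (i, j) else 0)"
  by (simp add: degree_part_def)

lemma degree_part_closed: "x \<in> carrier (UT n) \<Longrightarrow> degree_part h x \<in> carrier (UT n)"
  by (auto simp: carrier_UT_iff degree_part_def)

lemma component_subspace: "h \<in> carrier G \<Longrightarrow> linear_subspace (UT n) (\<Gamma> h)"
  using grading by (simp add: is_grading_def is_direct_sum_def)

lemma
  assumes "h \<in> carrier G"
  shows component_carrier: "x \<in> \<Gamma> h \<Longrightarrow> x \<in> carrier (UT n)"
    and component_zero: "0\<^sub>m n n \<in> \<Gamma> h"
    and component_add: "x \<in> \<Gamma> h \<Longrightarrow> y \<in> \<Gamma> h \<Longrightarrow> x + y \<in> \<Gamma> h"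
    and component_smult: "x \<in> \<Gamma> h \<Longrightarrow> c \<cdot>\<^sub>m x \<in> \<Gamma> h"
  using component_subspace[OF assms] subgroup.subset[of "\<Gamma> h" "add_monoid (UT n)"]
    subgroup.one_closed[of "\<Gamma> h" "add_monoid (UT n)"]
    subgroup.m_closed[of "\<Gamma> h" "add_monoid (UT n)"]
  by (auto simp: linear_subspace_def)

text \<open>
  The matrix is assembled from its entries one position at a time; each position contributes a
  multiple of a matrix unit of degree \<open>h\<close>, or nothing.
\<close>

lemma degree_part_in_component:
  assumes x: "x \<in> carrier (UT n)" and h: "h \<in> carrier G"
  shows "degree_part h x \<in> \<Gamma> h"
proof -
  define restr where
    "restr P = Matrix.mat n n (\<lambda>(i, j). if (i, j) \<in> P then degree_part h x $$ (i, j) else 0)" for P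
  have "restr P \<in> \<Gamma> h" if "finite P" for P
    using that
  proof (induction P)
    case empty
    have "restr {} = 0\<^sub>m n n" by (auto simp: restr_def)
    then show ?case using component_zero[OF h] by simp
  next
    case (insert p P)
    obtain i j where p: "p = (i, j)" by (cases p)
    show ?case
    proof (cases "i \<le> j \<and> j < n \<and> deg i j = h")
      case True
      then have "e_unit n i j \<in> \<Gamma> h"
        using e_unit_homogeneous by (auto simp: homogeneous_def deg_def)
      then have "restr P + x $$ (i, j) \<cdot>\<^sub>m e_unit n i j \<in> \<Gamma> h"
        using insert h by (simp add: component_add component_smult)
      also have "restr P + x $$ (i, j) \<cdot>\<^sub>m e_unit n i j = restr (insert p P)"
        using True insert by (intro eq_matI) (auto simp: restr_def p)
      finally show ?thesis .
    next
      case False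
      then have "restr (insert p P) = restr P"
        using UT_lower_entry[OF x, of i j] by (intro eq_matI) (auto simp: restr_def p)
      with insert show ?thesis by simp
    qed
  qed
  moreover have "restr ({..<n} \<times> {..<n}) = degree_part h x"
    by (intro eq_matI) (auto simp: restr_def degree_part_def)
  ultimately show ?thesis by (metis finite_SigmaI finite_lessThan)
qed

text \<open>
  An element of the component \<open>h\<close> has two decompositions into homogeneous elements: the trivial one
  with \<open>x\<close> itself in degree \<open>h\<close>, and the one into its degree parts.  They agree by uniqueness.
\<close>

lemma degree_part_of_component:
  assumes h: "h \<in> carrier G" and x: "x \<in> \<Gamma> h"
  shows "degree_part h x = x"
proof -
  note xc = component_carrier[OF h x]
  define S where "S f = {k \<in> carrier G. f k \<noteq> \<zero>\<^bsub>UT n\<^esub>}" for f :: "'a \<Rightarrow> 'k mat"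
  define decomposes where "decomposes f \<longleftrightarrow> f \<in> (\<Pi>\<^sub>E k\<in>carrier G. \<Gamma> k) \<and> finite (S f) \<and>
    x = (\<Oplus>\<^bsub>UT n\<^esub>k\<in>S f. f k)" for f
  define f1 where "f1 = (\<lambda>k\<in>carrier G. if k = h then x else 0\<^sub>m n n)"
  define f2 where "f2 = (\<lambda>k\<in>carrier G. degree_part k x)"
  have unique: "\<exists>!f. decomposes f"
    using grading xc unfolding is_grading_def is_direct_sum_def decomposes_def S_def by blast
  have sumI: "x = (\<Oplus>\<^bsub>UT n\<^esub>k\<in>S f. f k)"
    if "finite (S f)" "\<And>k. k \<in> carrier G \<Longrightarrow> f k \<in> carrier (UT n)"
      "\<And>i j. i < n \<Longrightarrow> j < n \<Longrightarrow> x $$ (i, j) = (\<Sum>k\<in>S f. f k $$ (i, j))" for f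
  proof -
    interpret UT: ring "UT n" by (rule ring_UT)
    have "f \<in> S f \<rightarrow> carrier (UT n)" using that(2) by (auto simp: S_def)
    then have "(\<Oplus>\<^bsub>UT n\<^esub>k\<in>S f. f k) \<in> carrier (UT n)" by (rule UT.finsum_closed)
    then show ?thesis
    proof (rule UT_eqI[OF xc])
      fix i j assume "i \<le> j" "j < n"
      then show "x $$ (i, j) = (\<Oplus>\<^bsub>UT n\<^esub>k\<in>S f. f k) $$ (i, j)"
        using that by (subst UT_finsum_entry) (auto simp: S_def)
    qed
  qed
  have "decomposes f1"
  proof -
    have sub: "S f1 \<subseteq> {h}" by (auto simp: S_def f1_def)
    then have fin: "finite (S f1)" using finite_subset by blast
    have "x $$ (i, j) = (\<Sum>k\<in>S f1. f1 k $$ (i, j))" if "i < n" "j < n" for i j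
    proof -
      have "(\<Sum>k\<in>S f1. f1 k $$ (i, j)) = (\<Sum>k\<in>{h}. f1 k $$ (i, j))"
        using sub that h by (intro sum.mono_neutral_left) (auto simp: S_def)
      then show ?thesis by (simp add: f1_def h)
    qed
    then have "x = (\<Oplus>\<^bsub>UT n\<^esub>k\<in>S f1. f1 k)"
      by (intro sumI[OF fin]) (simp_all add: f1_def xc UT_zero_closed)
    moreover have "f1 \<in> (\<Pi>\<^sub>E k\<in>carrier G. \<Gamma> k)" by (auto simp: f1_def x component_zero)
    ultimately show ?thesis using fin by (simp add: decomposes_def)
  qed
  moreover have "decomposes f2"
  proof -
    have sub: "S f2 \<subseteq> (\<lambda>(i, j). deg i j) ` ({..<n} \<times> {..<n})"
    proof
      fix k assume "k \<in> S f2"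
      then have "degree_part k x \<noteq> 0\<^sub>m n n" by (auto simp: S_def f2_def)
      then obtain i j where "i < n" "j < n" "deg i j = k"
        by (metis (no_types, lifting) degree_part_closed[OF xc] degree_part_entry UT_carrier_mat
          carrier_matD eq_matI index_zero_mat)
      then show "k \<in> (\<lambda>(i, j). deg i j) ` ({..<n} \<times> {..<n})" by force
    qed
    then have fin: "finite (S f2)" using finite_subset by blast
    have "x $$ (i, j) = (\<Sum>k\<in>S f2. f2 k $$ (i, j))" if ij: "i < n" "j < n" for i j
    proof -
      have "x $$ (i, j) = 0" if "deg i j \<notin> S f2"
      proof -
        have "degree_part (deg i j) x = 0\<^sub>m n n"
          using that deg_closed[OF ij] by (simp add: S_def f2_def)
        then show ?thesis using degree_part_entry[OF ij, of "deg i j" x] ij by simp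
      qed
      moreover have "(\<Sum>k\<in>S f2. f2 k $$ (i, j)) = (\<Sum>k\<in>S f2. if k = deg i j then x $$ (i, j) else 0)"
        by (rule sum.cong) (auto simp: S_def f2_def ij)
      ultimately show ?thesis using fin by auto
    qed
    then have "x = (\<Oplus>\<^bsub>UT n\<^esub>k\<in>S f2. f2 k)"
      by (intro sumI[OF fin]) (simp_all add: f2_def xc degree_part_closed)
    moreover have "f2 \<in> (\<Pi>\<^sub>E k\<in>carrier G. \<Gamma> k)"
      by (auto simp: f2_def degree_part_in_component xc)
    ultimately show ?thesis using fin by (simp add: decomposes_def)
  qed
  ultimately have "f1 h = f2 h" using unique by auto
  then show ?thesis by (simp add: f1_def f2_def h)
qed

lemma component_iff:
  assumes "h \<in> carrier G"
  shows "x \<in> \<Gamma> h \<longleftrightarrow> x \<in> carrier (UT n) \<and>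
    (\<forall>i j. i \<le> j \<and> j < n \<and> x $$ (i, j) \<noteq> 0 \<longrightarrow> deg i j = h)"
proof
  assume x: "x \<in> \<Gamma> h"
  have "deg i j = h" if "i \<le> j" "j < n" "x $$ (i, j) \<noteq> 0" for i j
    using degree_part_of_component[OF assms x] degree_part_entry[of i j h x] that by (auto split: if_splits)
  with component_carrier[OF assms x]
  show "x \<in> carrier (UT n) \<and> (\<forall>i j. i \<le> j \<and> j < n \<and> x $$ (i, j) \<noteq> 0 \<longrightarrow> deg i j = h)"
    by blast
next
  assume *: "x \<in> carrier (UT n) \<and> (\<forall>i j. i \<le> j \<and> j < n \<and> x $$ (i, j) \<noteq> 0 \<longrightarrow> deg i j = h)"
  then have x: "x \<in> carrier (UT n)"
    and deg: "\<And>i j. i \<le> j \<Longrightarrow> j < n \<Longrightarrow> x $$ (i, j) \<noteq> 0 \<Longrightarrow> deg i j = h" by blast+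
  have "degree_part h x = x"
    by (rule UT_eqI[OF degree_part_closed[OF x] x]) (use deg in fastforce)
  with degree_part_in_component[of x h] * assms show "x \<in> \<Gamma> h" by simp
qed

lemma e_unit_component: "i \<le> j \<Longrightarrow> j < n \<Longrightarrow> e_unit n i j \<in> \<Gamma> (deg i j)"
  using e_unit_homogeneous by (simp add: homogeneous_def deg_def)

lemma deg_Supp: "i \<le> j \<Longrightarrow> j < n \<Longrightarrow> deg i j \<in> Supp G (UT n) \<Gamma>"
  using e_unit_component[of i j] e_unit_nonzero[of i n j, where 'k = 'k] deg_closed[of i j]
  by (auto simp: Supp_def)

lemma Supp_carrier: "h \<in> Supp G (UT n) \<Gamma> \<Longrightarrow> h \<in> carrier G"
  by (simp add: Supp_def)

lemma one_component: "1\<^sub>m n \<in> \<Gamma> \<one>"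
  by (auto simp: component_iff UT_one_closed deg_self split: if_splits)

lemma one_Supp: "\<one> \<in> Supp G (UT n) \<Gamma>"
  using deg_Supp[of 0 0] deg_self[of 0] n_pos by simp

lemma one_component_unique:
  assumes "h \<in> carrier G" "1\<^sub>m n \<in> \<Gamma> h"
  shows "h = \<one>"
proof -
  have "deg 0 0 = h" using assms n_pos unfolding component_iff[OF assms(1)] by fastforce
  then show ?thesis using deg_self[OF n_pos] by simp
qed

lemma component_mult:
  assumes "h \<in> carrier G" "k \<in> carrier G" "x \<in> \<Gamma> h" "y \<in> \<Gamma> k"
  shows "x * y \<in> \<Gamma> (h \<otimes> k)"
proof -
  have "x * y \<in> \<Gamma> h <#>\<^bsub>UT n\<^esub> \<Gamma> k" using assms(3,4) by (auto simp: set_mult_def)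
  then show ?thesis using grading assms(1,2) unfolding is_grading_def by blast
qed

text \<open>
  Multiplication by \<open>a\<close> from the left commutes with taking the part of neutral degree, since a nonzero
  entry \<open>a\<^sub>i\<^sub>k\<close> forces \<open>deg i j = deg k j\<close>.  So the neutral part of the inverse is also a right inverse
  of \<open>a\<close>, and it must be the whole inverse.
\<close>

lemma component_inverse:
  assumes a: "a \<in> Units (UT n)" "a \<in> \<Gamma> \<one>"
  shows "inv\<^bsub>UT n\<^esub> a \<in> \<Gamma> \<one>"
proof -
  define b where "b = inv\<^bsub>UT n\<^esub> a"
  have cl: "a \<in> carrier (UT n)" "b \<in> carrier (UT n)" "degree_part \<one> b \<in> carrier (UT n)"
    using Units_UT_closed[OF a(1)] by (simp_all add: b_def degree_part_closed)
  have inv: "a * b = 1\<^sub>m n" "b * a = 1\<^sub>m n" using Units_UT_inv[OF a(1)] by (simp_all add: b_def)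
  have "a * degree_part \<one> b = 1\<^sub>m n"
  proof (rule UT_eqI)
    fix i j assume ij: "i \<le> j" "j < n"
    have "(a * degree_part \<one> b) $$ (i, j) = (\<Sum>k<n. a $$ (i, k) * degree_part \<one> b $$ (k, j))"
      using mult_entry[OF cl(1,3)[THEN UT_carrier_mat]] ij by simp
    also have "\<dots> = (\<Sum>k<n. if deg i j = \<one> then a $$ (i, k) * b $$ (k, j) else 0)"
    proof (rule sum.cong[OF HOL.refl])
      fix k assume k: "k \<in> {..<n}"
      show "a $$ (i, k) * degree_part \<one> b $$ (k, j) =
        (if deg i j = \<one> then a $$ (i, k) * b $$ (k, j) else 0)"
      proof (cases "a $$ (i, k) = 0")
        case False
        then have "i \<le> k" using UT_lower_entry[OF cl(1), of i k] ij by force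
        with False have "deg i k = \<one>" using a(2) k by (simp add: component_iff)
        then have "deg i j = deg k j" using deg_mult[of i k j] deg_closed[of k j] ij k by simp
        then show ?thesis using ij k by simp
      qed simp
    qed
    also have "\<dots> = (if deg i j = \<one> then (a * b) $$ (i, j) else 0)"
      using mult_entry[OF cl(1,2)[THEN UT_carrier_mat], of i j] ij by simp
    also have "\<dots> = 1\<^sub>m n $$ (i, j)" using inv(1) ij by (auto simp: deg_self)
    finally show "(a * degree_part \<one> b) $$ (i, j) = 1\<^sub>m n $$ (i, j)" .
  qed (simp_all add: cl UT_mult_closed UT_one_closed)
  then have "b * (a * degree_part \<one> b) = b" using UT_carrier_mat[OF cl(2)] by simp
  then have "degree_part \<one> b = b"
    using assoc_mult_mat[OF cl(2,1,3)[THEN UT_carrier_mat]] inv(2) UT_carrier_mat[OF cl(3)] by simp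
  then show ?thesis using degree_part_in_component[OF cl(2), of \<one>] by (simp add: b_def)
qed

lemma conj_map_preserves_component:
  assumes a: "a \<in> Units (UT n)" "a \<in> \<Gamma> \<one>" and h: "h \<in> carrier G" and x: "x \<in> \<Gamma> h"
  shows "conj_map n a x \<in> \<Gamma> h"
proof -
  have "a * x * inv\<^bsub>UT n\<^esub> a \<in> \<Gamma> (\<one> \<otimes> h \<otimes> \<one>)"
    using assms component_inverse[OF a] by (intro component_mult) simp_all
  then show ?thesis using h component_carrier[OF h x] by (simp add: conj_map_apply[OF a(1)])
qed

lemma conj_map_in_Stab:
  assumes a: "a \<in> Units (UT n)" "a \<in> \<Gamma> \<one>"
  shows "conj_map n a \<in> Stab_grading G (UT n) \<Gamma>"
proof -
  have "conj_map n a ` \<Gamma> h = \<Gamma> h" if h: "h \<in> carrier G" for h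
  proof (intro equalityI subsetI)
    fix y assume "y \<in> conj_map n a ` \<Gamma> h"
    then show "y \<in> \<Gamma> h" using conj_map_preserves_component[OF a h] by blast
  next
    fix y assume y: "y \<in> \<Gamma> h"
    have "conj_map n (inv\<^bsub>UT n\<^esub> a) y \<in> \<Gamma> h"
      by (rule conj_map_preserves_component[OF Units_UT_inv(1)[OF a(1)] component_inverse[OF a] h y])
    moreover have "y = conj_map n a (conj_map n (inv\<^bsub>UT n\<^esub> a) y)"
      using conj_map_inverse(1)[OF a(1) component_carrier[OF h y]] by simp
    ultimately show "y \<in> conj_map n a ` \<Gamma> h" by blast
  qed
  then show ?thesis
    using conj_map_algebra_aut[OF a(1)] by (simp add: Stab_grading_def)
qed

section \<open>Self-equivalences of an elementary grading\<close>

lemma Stab_subset_Aut: "Stab_grading G (UT n) \<Gamma> \<subseteq> Aut_grading G (UT n) \<Gamma>"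
  unfolding Stab_grading_def Aut_grading_def using Supp_carrier by blast

text \<open>
  The identity matrix is fixed and lies in only one component, so the neutral component is mapped to
  itself; this puts the frame, and with it the conjugating matrix, in neutral degree.
\<close>

lemma Aut_grading_inner:
  assumes f: "f \<in> Aut_grading G (UT n) \<Gamma>"
  shows "\<exists>a. f = conj_map n a \<and> a \<in> Units (UT n) \<and> a \<in> \<Gamma> \<one>"
proof -
  have aut: "f \<in> algebra_aut (UT n)" using f by (simp add: Aut_grading_def)
  obtain h where h: "h \<in> Supp G (UT n) \<Gamma>" "f ` \<Gamma> \<one> = \<Gamma> h"
    using f one_Supp by (auto simp: Aut_grading_def)
  have "1\<^sub>m n \<in> \<Gamma> h" using h(2) one_component UT_aut_one[OF aut] by force
  then have f_one: "f ` \<Gamma> \<one> = \<Gamma> \<one>" using h one_component_unique Supp_carrier by blast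
  obtain d where d: "\<And>i. i < n \<Longrightarrow> d i \<noteq> 0"
    and inner: "f = conj_map n (idempotent_frame n f * mat_diag n d)"
    using UT_aut_inner[OF aut] by blast
  have unit: "idempotent_frame n f * mat_diag n d \<in> Units (UT n)"
    by (rule Units_UT_mult[OF idempotent_frame_Units[OF aut] mat_diag_Units(1)[OF d]])
  have entry: "(idempotent_frame n f * mat_diag n d) $$ (i, j) = f (e_unit n j j) $$ (i, j) * d j"
    if "i < n" "j < n" for i j
    using that by (simp add: mat_diag_mult_right[of _ n n] idempotent_frame_def)
  have "deg i j = \<one>" if ij: "i \<le> j" "j < n" "f (e_unit n j j) $$ (i, j) \<noteq> 0" for i j
  proof -
    have "f (e_unit n j j) \<in> \<Gamma> \<one>"
      using f_one e_unit_component[of j j] deg_self[of j] ij by auto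
    with ij show ?thesis by (simp add: component_iff)
  qed
  then have "idempotent_frame n f * mat_diag n d \<in> \<Gamma> \<one>"
    using Units_UT_closed(1)[OF unit] entry by (auto simp: component_iff)
  with unit inner show ?thesis by blast
qed

lemma Units_nonzero: "a \<in> Units (UT n) \<Longrightarrow> a \<noteq> 0\<^sub>m n n"
  using n_pos Units_UT_iff[OF Units_UT_closed(1), of a n] by force

theorem Stab_eq_inner:
  "Stab_grading G (UT n) \<Gamma> =
    {conj_map n a | a. a \<in> Units (UT n) \<and> homogeneous (UT n) \<Gamma> \<one> a}"
  using Stab_subset_Aut Aut_grading_inner conj_map_in_Stab Units_nonzero
  unfolding homogeneous_def UT_sel by blast

theorem Aut_eq_Stab: "Aut_grading G (UT n) \<Gamma> = Stab_grading G (UT n) \<Gamma>"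
  using Stab_subset_Aut Aut_grading_inner conj_map_in_Stab by blast

end

section \<open>The Weyl group\<close>

lemma (in group) trivial_Mod_carrier: "trivial_group (G Mod carrier G)"
proof -
  have "group (G Mod carrier G)" by (rule normal.factorgroup_is_group[OF normal_self])
  moreover have "carrier (G Mod carrier G) = {carrier G}"
    using coset_join2[OF _ subgroup_self] one_closed by (auto simp: carrier_FactGroup image_iff)
  ultimately show ?thesis by (simp add: trivial_group_def)
qed

context elementary_UT
begin

text \<open>
  As conjugations by the units of neutral degree, the graded automorphisms are closed under
  composition and inversion because these units are closed under multiplication and inversion.
\<close>

lemma Stab_subgroup:
  "subgroup (Stab_grading G (UT n) \<Gamma>) (BijGroup (carrier (UT n)))"
proof -
  let ?B = "BijGroup (carrier (UT n :: ('k, 'k mat) module))"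
  interpret B: group ?B by (rule group_BijGroup)
  have bij: "conj_map n a \<in> Bij (carrier (UT n))" if "a \<in> Units (UT n)" for a :: "'k mat"
    using conj_map_algebra_aut[OF that] by (simp add: algebra_aut_def)
  have mult: "conj_map n a \<otimes>\<^bsub>?B\<^esub> conj_map n b = conj_map n (a * b)"
    if "a \<in> Units (UT n)" "b \<in> Units (UT n)" for a b :: "'k mat"
  proof (rule extensionalityI[of _ "carrier (UT n)"])
    fix x :: "'k mat" assume "x \<in> carrier (UT n)"
    then show "(conj_map n a \<otimes>\<^bsub>?B\<^esub> conj_map n b) x = conj_map n (a * b) x"
      using that bij by (simp add: BijGroup_def compose_def conj_map_conj_map)
  qed (use that bij in \<open>auto simp: BijGroup_def conj_map_def[of n "a * b"]\<close>)
  have one: "conj_map n (1\<^sub>m n) = \<one>\<^bsub>?B\<^esub>"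
  proof (rule extensionalityI[of _ "carrier (UT n)"])
    fix x :: "'k mat" assume "x \<in> carrier (UT n)"
    then show "conj_map n (1\<^sub>m n) x = \<one>\<^bsub>?B\<^esub> x" by (simp add: BijGroup_def conj_map_one)
  qed (auto simp: BijGroup_def conj_map_def)
  show ?thesis
  proof (rule B.subgroupI)
    show "Stab_grading G (UT n) \<Gamma> \<subseteq> carrier ?B"
      by (auto simp: Stab_grading_def algebra_aut_def BijGroup_def)
    have "1\<^sub>m n \<in> Units (UT n)" using monoid.Units_one_closed[OF monoid_UT, of n] by simp
    then show "Stab_grading G (UT n) \<Gamma> \<noteq> {}" using conj_map_in_Stab one_component by blast
  next
    fix f assume "f \<in> Stab_grading G (UT n) \<Gamma>"
    then obtain a where a: "f = conj_map n a" "a \<in> Units (UT n)" "a \<in> \<Gamma> \<one>"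
      using Stab_subset_Aut Aut_grading_inner by blast
    have "inv\<^bsub>?B\<^esub> f = conj_map n (inv\<^bsub>UT n\<^esub> a)"
      using mult[OF Units_UT_inv(1)[OF a(2)] a(2)] bij a Units_UT_inv[OF a(2)] one
      by (intro B.inv_equality) (simp_all add: BijGroup_def)
    then show "inv\<^bsub>?B\<^esub> f \<in> Stab_grading G (UT n) \<Gamma>"
      using conj_map_in_Stab[OF Units_UT_inv(1)[OF a(2)] component_inverse[OF a(2,3)]] by simp
    fix f' assume "f' \<in> Stab_grading G (UT n) \<Gamma>"
    then obtain b where b: "f' = conj_map n b" "b \<in> Units (UT n)" "b \<in> \<Gamma> \<one>"
      using Stab_subset_Aut Aut_grading_inner by blast
    have "a * b \<in> \<Gamma> \<one>" using component_mult[of \<one> \<one> a b] a b by simp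
    then show "f \<otimes>\<^bsub>?B\<^esub> f' \<in> Stab_grading G (UT n) \<Gamma>"
      using mult a b conj_map_in_Stab[OF Units_UT_mult[OF a(2) b(2)]] by simp
  qed
qed

theorem Weyl_group_trivial: "trivial_group (Weyl_group G (UT n) \<Gamma>)"
  using group.trivial_Mod_carrier[OF subgroup.subgroup_is_group[OF Stab_subgroup group_BijGroup]]
  by (simp add: Weyl_group_def Aut_eq_Stab)

section \<open>Diagonal automorphisms and characters\<close>

abbreviation udeg :: "'a \<Rightarrow> 'a word set" where
  "udeg \<equiv> universal_deg G (UT n) \<Gamma>"

text \<open>
  The product \<open>e\<^sub>i\<^sub>j e\<^sub>j\<^sub>k = e\<^sub>i\<^sub>k \<noteq> 0\<close> witnesses a defining relation of the universal group.
\<close>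

lemma udeg_mult:
  assumes "i \<le> j" "j \<le> k" "k < n"
  shows "udeg (deg i j) \<otimes>\<^bsub>universal_group G (UT n) \<Gamma>\<^esub> udeg (deg j k) = udeg (deg i k)"
proof -
  note S = deg_Supp[of i j] deg_Supp[of j k] deg_Supp[of i k]
  have sub: "\<Gamma> (deg i j) <#>\<^bsub>UT n\<^esub> \<Gamma> (deg j k) \<subseteq> \<Gamma> (deg i k)"
    using component_mult[of "deg i j" "deg j k"] deg_mult[of i j k] deg_closed assms
    by (auto simp: set_mult_def)
  have "e_unit n i j * e_unit n j k \<in> \<Gamma> (deg i j) <#>\<^bsub>UT n\<^esub> \<Gamma> (deg j k)"
    using e_unit_component assms by (force simp: set_mult_def)
  then have "\<not> \<Gamma> (deg i j) <#>\<^bsub>UT n\<^esub> \<Gamma> (deg j k) \<subseteq> {\<zero>\<^bsub>UT n\<^esub>}"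
    using e_unit_nonzero[of i n k, where 'k = 'k] assms by (auto simp: e_unit_mult)
  with sub S assms have
    "([(deg i j, True), (deg j k, True)], [(deg i k, True)]) \<in> universal_rels G (UT n) \<Gamma>"
    by (auto simp: universal_rels_def)
  from presented_group_gen_mult[OF this] S assms show ?thesis
    by (simp add: universal_deg_def universal_group_def)
qed

lemma character_nonzero:
  assumes "\<chi> \<in> characters (universal_group G (UT n) \<Gamma>)" "h \<in> Supp G (UT n) \<Gamma>"
  shows "(\<chi> (udeg h) :: 'k) \<noteq> 0"
  using assms pres_gen_closed[OF assms(2)]
  by (auto simp: characters_def universal_group_def universal_deg_def hom_def)

lemma character_mult:
  assumes \<chi>: "\<chi> \<in> characters (universal_group G (UT n) \<Gamma>)" and "i \<le> j" "j \<le> k" "k < n"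
  shows "(\<chi> (udeg (deg i k)) :: 'k) = \<chi> (udeg (deg i j)) * \<chi> (udeg (deg j k))"
proof -
  have "udeg h \<in> carrier (universal_group G (UT n) \<Gamma>)" if "h \<in> Supp G (UT n) \<Gamma>" for h
    using pres_gen_closed[OF that] by (simp add: universal_group_def universal_deg_def)
  then have "\<chi> (udeg (deg i j) \<otimes>\<^bsub>universal_group G (UT n) \<Gamma>\<^esub> udeg (deg j k)) =
      \<chi> (udeg (deg i j)) * \<chi> (udeg (deg j k))"
    using hom_mult[of \<chi> "universal_group G (UT n) \<Gamma>" field_units] assms
    by (simp add: characters_def deg_Supp)
  then show ?thesis using udeg_mult[OF assms(2-)] by simp
qed

lemma character_one:
  assumes "\<chi> \<in> characters (universal_group G (UT n) \<Gamma>)"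
  shows "(\<chi> (udeg \<one>) :: 'k) = 1"
  using character_mult[OF assms, of 0 0 0] character_nonzero[OF assms one_Supp] n_pos
  by (simp add: deg_self)

text \<open>
  The first entry fits the pattern of the others because \<open>deg 0 0\<close> is neutral and the relation
  \<open>e\<^sub>0\<^sub>0 e\<^sub>0\<^sub>0 = e\<^sub>0\<^sub>0\<close> makes every character trivial there.
\<close>

lemma char_diag_eq:
  assumes "\<chi> \<in> characters (universal_group G (UT n) \<Gamma>)"
  shows "char_diag G n \<Gamma> g \<chi> = mat_diag n (\<lambda>j. inverse (\<chi> (udeg (deg 0 j))))"
  using character_one[OF assms] n_pos
  by (auto simp: char_diag_def mat_diag_def deg_0 g_0 intro!: eq_matI)

text \<open>
  Conjugation by \<open>diag(d\<^sub>0, d\<^sub>1, \<dots>)\<close> scales the entry \<open>(i, j)\<close> by \<open>d\<^sub>i / d\<^sub>j\<close>, which is the value of the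
  character on \<open>deg i j\<close> and so depends on the degree only.
\<close>

lemma conj_char_diag_in_Diag:
  assumes \<chi>: "\<chi> \<in> characters (universal_group G (UT n) \<Gamma>)"
  shows "conj_map n (char_diag G n \<Gamma> g \<chi>) \<in> Diag_grading G (UT n) \<Gamma>"
proof -
  define d where "d j = inverse (\<chi> (udeg (deg 0 j)))" for j
  have d: "d j \<noteq> 0" if "j < n" for j
    using character_nonzero[OF \<chi> deg_Supp[of 0 j]] that by (simp add: d_def)
  have eq: "char_diag G n \<Gamma> g \<chi> = mat_diag n d"
    using char_diag_eq[OF \<chi>] by (simp add: d_def[abs_def])
  have unit: "mat_diag n d \<in> Units (UT n)" using mat_diag_Units(1) d by blast
  have "mat_diag n d \<in> \<Gamma> \<one>"
    using Units_UT_closed(1)[OF unit] by (auto simp: component_iff mat_diag_def deg_self split: if_splits)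
  with unit have stab: "conj_map n (mat_diag n d) \<in> Stab_grading G (UT n) \<Gamma>"
    by (rule conj_map_in_Stab)
  have "conj_map n (mat_diag n d) x = \<chi> (udeg h) \<cdot>\<^sub>m x"
    if h: "h \<in> Supp G (UT n) \<Gamma>" and x: "x \<in> \<Gamma> h" for h x
  proof (rule UT_eqI)
    have xc: "x \<in> carrier (UT n)" using component_carrier[OF Supp_carrier[OF h] x] .
    then show "conj_map n (mat_diag n d) x \<in> carrier (UT n)" "\<chi> (udeg h) \<cdot>\<^sub>m x \<in> carrier (UT n)"
      using unit by (simp_all add: conj_map_closed UT_smult_closed)
    fix i j assume ij: "i \<le> j" "j < n"
    have lhs: "conj_map n (mat_diag n d) x $$ (i, j) = d i * x $$ (i, j) / d j"
      using conj_map_mat_diag_entry[of n d x i j] d xc ij by simp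
    show "conj_map n (mat_diag n d) x $$ (i, j) = (\<chi> (udeg h) \<cdot>\<^sub>m x) $$ (i, j)"
    proof (cases "x $$ (i, j) = 0")
      case False
      then have "deg i j = h" using x ij Supp_carrier[OF h] by (simp add: component_iff)
      moreover have "\<chi> (udeg (deg 0 i)) \<noteq> 0" using character_nonzero[OF \<chi> deg_Supp[of 0 i]] ij by simp
      ultimately have "d i / d j = \<chi> (udeg h)"
        using character_mult[OF \<chi>, of 0 i j] ij
        by (simp add: d_def divide_inverse flip: mult.assoc)
      then have "d i = \<chi> (udeg h) * d j" using d[of j] ij by (simp add: divide_eq_eq)
      then show ?thesis using lhs d[of j] ij UT_carrier_mat[OF xc] by simp
    qed (use lhs ij UT_carrier_mat[OF xc] in simp)
  qed
  with stab show ?thesis unfolding eq Diag_grading_def by auto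
qed

text \<open>
  The eigenvalues \<open>\<phi>\<close> of the automorphism on the components satisfy the relations of the universal
  group, so they extend to a character.  It is trivial on the neutral degree, which means that the
  automorphism fixes every \<open>e\<^sub>i\<^sub>i\<close>, and its first-row factors are values of the character.
\<close>

lemma Diag_is_conj_char_diag:
  assumes f: "f \<in> Diag_grading G (UT n) \<Gamma>"
  obtains \<chi> where "\<chi> \<in> characters (universal_group G (UT n) \<Gamma>)"
    and "f = conj_map n (char_diag G n \<Gamma> g \<chi>)"
proof -
  have aut: "f \<in> algebra_aut (UT n)" using f by (simp add: Diag_grading_def Stab_grading_def)
  obtain \<phi> where \<phi>: "\<And>h x. h \<in> Supp G (UT n) \<Gamma> \<Longrightarrow> x \<in> \<Gamma> h \<Longrightarrow> f x = \<phi> h \<cdot>\<^sub>m x"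
    using f unfolding Diag_grading_def UT_sel by simp metis
  have nz: "\<phi> h \<noteq> 0" if h: "h \<in> Supp G (UT n) \<Gamma>" for h
  proof
    assume z: "\<phi> h = 0"
    obtain x where x: "x \<in> \<Gamma> h" "x \<noteq> 0\<^sub>m n n"
      using h component_zero[of h] by (auto simp: Supp_def)
    have xc: "x \<in> carrier (UT n)" using component_carrier[OF Supp_carrier[OF h] x(1)] .
    have "f x = 0\<^sub>m n n" using \<phi>[OF h x(1)] z UT_carrier_mat[OF xc] by (auto intro!: eq_matI)
    with UT_aut_nonzero[OF aut xc x(2)] show False by simp
  qed
  have rels: "\<phi> b * \<phi> c = \<phi> a"
    if abc: "a \<in> Supp G (UT n) \<Gamma>" "b \<in> Supp G (UT n) \<Gamma>" "c \<in> Supp G (UT n) \<Gamma>"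
      and nonzero: "\<not> \<Gamma> b <#>\<^bsub>UT n\<^esub> \<Gamma> c \<subseteq> {\<zero>\<^bsub>UT n\<^esub>}" and sub: "\<Gamma> b <#>\<^bsub>UT n\<^esub> \<Gamma> c \<subseteq> \<Gamma> a"
    for a b c
  proof -
    obtain x y where xy: "x \<in> \<Gamma> b" "y \<in> \<Gamma> c" "x * y \<noteq> 0\<^sub>m n n"
      using nonzero by (auto simp: set_mult_def)
    have xc: "x \<in> carrier (UT n)" "y \<in> carrier (UT n)"
      using component_carrier xy abc Supp_carrier by blast+
    have xya: "x * y \<in> \<Gamma> a" using sub xy by (auto simp: set_mult_def)
    have "\<phi> a \<cdot>\<^sub>m (x * y) = f x * f y"
      using \<phi>[OF abc(1) xya] UT_aut_mult[OF aut xc] by simp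
    also have "\<dots> = (\<phi> b \<cdot>\<^sub>m x) * (\<phi> c \<cdot>\<^sub>m y)" using \<phi> abc xy by simp
    also have "\<dots> = (\<phi> b * \<phi> c) \<cdot>\<^sub>m (x * y)"
      using xc[THEN UT_carrier_mat]
      by (intro eq_matI)
        (auto simp: mult_smult_distrib[of _ n n _ n] mult_smult_assoc_mat[of _ n n _ n])
    finally have eq: "\<phi> a \<cdot>\<^sub>m (x * y) = (\<phi> b * \<phi> c) \<cdot>\<^sub>m (x * y)" .
    have m: "x * y \<in> carrier_mat n n" using xc by (intro UT_carrier_mat UT_mult_closed)
    obtain i j where ij: "i < n" "j < n" "(x * y) $$ (i, j) \<noteq> 0"
      using xy(3) m by (metis carrier_matD eq_matI index_zero_mat)
    have "(\<phi> a \<cdot>\<^sub>m (x * y)) $$ (i, j) = ((\<phi> b * \<phi> c) \<cdot>\<^sub>m (x * y)) $$ (i, j)" using eq by simp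
    then show ?thesis using ij carrier_matD[OF m] by (simp del: index_mult_mat)
  qed
  interpret K: group "field_units :: 'k monoid" by (rule group_field_units)
  have word_rels: "word_eval field_units \<phi> l = word_eval field_units \<phi> r"
    if "(l, r) \<in> universal_rels G (UT n) \<Gamma>" for l r
  proof -
    from that obtain a b c where "l = [(b, True), (c, True)]" "r = [(a, True)]"
      and "a \<in> Supp G (UT n) \<Gamma>" "b \<in> Supp G (UT n) \<Gamma>" "c \<in> Supp G (UT n) \<Gamma>"
        "\<not> \<Gamma> b <#>\<^bsub>UT n\<^esub> \<Gamma> c \<subseteq> {\<zero>\<^bsub>UT n\<^esub>}" "\<Gamma> b <#>\<^bsub>UT n\<^esub> \<Gamma> c \<subseteq> \<Gamma> a"
      unfolding universal_rels_def by blast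
    with rels[of a b c] show ?thesis by (simp add: word_eval_def)
  qed
  have "\<phi> \<in> Supp G (UT n) \<Gamma> \<rightarrow> carrier field_units" using nz by auto
  from K.presented_group_hom_exists[OF this word_rels]
  obtain \<chi> where \<chi>: "\<chi> \<in> characters (universal_group G (UT n) \<Gamma>)"
    and \<chi>\<phi>: "\<And>h. h \<in> Supp G (UT n) \<Gamma> \<Longrightarrow> \<chi> (udeg h) = \<phi> h"
    unfolding characters_def universal_group_def universal_deg_def by metis
  \<comment> \<open>As a character is trivial on the neutral degree, every \<open>e\<^sub>i\<^sub>i\<close> is fixed.\<close>
  have "\<phi> \<one> = 1" using \<chi>\<phi>[OF one_Supp] character_one[OF \<chi>] by simp
  then have "f (e_unit n i i) = e_unit n i i" if "i < n" for i
    using \<phi>[OF one_Supp] e_unit_component[of i i] deg_self[OF that] that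
    by (auto intro!: eq_matI)
  moreover have "inverse (\<chi> (udeg (deg 0 i))) = inverse (f (e_unit n 0 i) $$ (0, i))" if "i < n" for i
    using \<phi>[OF deg_Supp e_unit_component, of 0 i] \<chi>\<phi>[OF deg_Supp[of 0 i]] that n_pos by simp
  ultimately have "f = conj_map n (mat_diag n (\<lambda>j. inverse (\<chi> (udeg (deg 0 j)))))"
    by (rule fixing_aut_eq_conj_diag[OF aut])
  with \<chi> char_diag_eq[OF \<chi>] that show ?thesis by metis
qed

theorem Diag_eq_conj_char_diag:
  "Diag_grading G (UT n) \<Gamma> =
    {conj_map n (char_diag G n \<Gamma> g \<chi>) | \<chi>. \<chi> \<in> characters (universal_group G (UT n) \<Gamma>)}"
  using conj_char_diag_in_Diag by (auto elim: Diag_is_conj_char_diag)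

end

theorem theorem1:
  fixes G :: "('g, 'm) monoid_scheme"
    and n :: nat
    and \<Gamma> :: "'g \<Rightarrow> 'k::field mat set"
    and g :: "nat \<Rightarrow> 'g"
  assumes "group G"
    and "n \<ge> 1"
    and "elementary_grading G n \<Gamma>"
    and "\<forall>i<n. g i \<in> carrier G"
    and "g 0 = \<one>\<^bsub>G\<^esub>"
    and "\<forall>i j. i \<le> j \<and> j < n \<longrightarrow>
           homogeneous (UT n) \<Gamma> (g i \<otimes>\<^bsub>G\<^esub> inv\<^bsub>G\<^esub> (g j)) (e_unit n i j)"
  shows "Aut_grading G (UT n) \<Gamma> = Stab_grading G (UT n) \<Gamma> \<and>
    Stab_grading G (UT n) \<Gamma> =
      {conj_map n a | a. a \<in> Units (UT n) \<and> homogeneous (UT n) \<Gamma> \<one>\<^bsub>G\<^esub> a} \<and>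
    trivial_group (Weyl_group G (UT n) \<Gamma>) \<and>
    Diag_grading G (UT n) \<Gamma> =
      {conj_map n (char_diag G n \<Gamma> g \<chi>) | \<chi>. \<chi> \<in> characters (universal_group G (UT n) \<Gamma>)}"
proof -
  interpret elementary_UT G n \<Gamma> g
    using assms by (simp add: elementary_UT_def elementary_UT_axioms_def elementary_grading_def)
  show ?thesis
    using Aut_eq_Stab Stab_eq_inner Weyl_group_trivial Diag_eq_conj_char_diag by blast
qed

end
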